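(* Let $m\ge 2$ be an integer, let $\varepsilon\in\mathbb{R}$ with $\varepsilon^2=1$, and let $\varepsilon^{1/m}\in\mathbb{C}$ be an $m$-th root of $\varepsilon$. Then for all $x,y\in\mathbb{C}$, $$\widehat{\prod_{k=0}^{\infty}}\left((k+x)^m-\varepsilon y^m\right)=\prod_{\xi\in\mathbb{C},\ \xi^m=1} L\left(x-\xi\,\varepsilon^{1/m}y\right),$$ where $L(x)=\widehat{\prod}_{k=0}^{\infty}(k+x)$ and $\widehat{\prod}$ denotes the zeta-regularized product.
   Context: Regularized product: let $0<b_0\le b_1\le b_2\le\dots$ be real numbers such that $\zeta(s)=\sum_{k\ge 0} b_k^{-s}$ converges absolutely for $\mathrm{Re}(s)$ large and continues meromorphically to $\mathbb{C}$, holomorphically at $s=0$. Then $\widehat{\prod}_{k=0}^\infty b_k:=\exp(-\zeta'(0))$. The function $L$: for real $x>0$, $L(x)=\widehat{\prod}_{k=0}^\infty (k+x)=\exp\left(-\frac{\partial}{\partial s}\zeta_H(s,x)|_{s=0}\right)$, where $\zeta_H(s,x)=\sum_{k=0}^\infty (k+x)^{-s}$ is the Hurwitz zeta function (meromorphically continued in $s$). $L$ is extended to an entire function on $\mathbb{C}$ by analytic continuation. Concretely, for $x\in\mathbb{C}$ and any integer $N\ge 0$ with $\mathrm{Re}(x)+N>0$, $L(x)=L(x+N)\prod_{n=0}^{N-1}(n+x)$. Regularized product with complex parameters: for real $x,y$ with $0\le y<x$, all numbers $(k+x)^m-\varepsilon y^m$ ($k\ge 0$) are positive and nondecreasing in $k$,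 and $\widehat{\prod}_{k=0}^{\infty}((k+x)^m-\varepsilon y^m)$ is given by the definition above. For general $(x,y)\in\mathbb{C}^2$ it denotes the value at $(x,y)$ of the analytic continuation of this function to $\mathbb{C}^2$. *)

theory Defs
  imports "HOL-Complex_Analysis.Complex_Analysis"
begin

(* The value of Z at a point outside the half-plane may be changed on a discrete set away from 0
   without affecting "meromorphic_on"; by the identity theorem the germ of Z at 0 is nevertheless
   determined by b. *)
definition zeta_continuation :: "(nat \<Rightarrow> real) \<Rightarrow> (complex \<Rightarrow> complex) \<Rightarrow> bool" where
  "zeta_continuation b Z \<longleftrightarrow>
     Z meromorphic_on UNIV \<and> Z analytic_on {0} \<and>
     (\<exists>\<sigma>::real. \<forall>s. Re s > \<sigma> \<longrightarrow>
        summable (\<lambda>k. norm (complex_of_real (b k) powr (- s))) \<and>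
        Z s = (\<Sum>k. complex_of_real (b k) powr (- s)))"

(* "b admits a zeta-regularized product, and its value is P" (P is unique, see above). *)
definition has_zeta_regprod :: "(nat \<Rightarrow> real) \<Rightarrow> complex \<Rightarrow> bool"
    (infixr "has'_zeta'_regprod" 46) where
  "b has_zeta_regprod P \<longleftrightarrow>
     (\<forall>k. 0 < b k) \<and> incseq b \<and>
     (\<exists>Z. zeta_continuation b Z \<and> P = exp (- deriv Z 0))"

definition is_L_continuation :: "(complex \<Rightarrow> complex) \<Rightarrow> bool" where
  "is_L_continuation F \<longleftrightarrow>
     F holomorphic_on UNIV \<and>
     (\<forall>x::real. 0 < x \<longrightarrow> (\<lambda>k. real k + x) has_zeta_regprod F (complex_of_real x))"

definition L :: "complex \<Rightarrow> complex" where
  "L = (THE F. is_L_continuation F)"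

(* Holomorphy on C^2: Frechet differentiability with complex-linear derivative. *)
definition entire2 :: "(complex \<times> complex \<Rightarrow> complex) \<Rightarrow> bool" where
  "entire2 F \<longleftrightarrow> (\<forall>p. \<exists>a b. (F has_derivative (\<lambda>(u, v). a * u + b * v)) (at p))"

definition is_regprod_continuation ::
    "nat \<Rightarrow> real \<Rightarrow> (complex \<times> complex \<Rightarrow> complex) \<Rightarrow> bool" where
  "is_regprod_continuation m \<epsilon> F \<longleftrightarrow>
     entire2 F \<and>
     (\<forall>x y::real. 0 \<le> y \<and> y < x \<longrightarrow>
        (\<lambda>k. (real k + x) ^ m - \<epsilon> * y ^ m)
          has_zeta_regprod F (complex_of_real x, complex_of_real y))"

(* The regularized product of (k + x)^m - \<epsilon> y^m over k \<ge> 0, for arbitrary complex x and y. *)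
definition regprod :: "nat \<Rightarrow> real \<Rightarrow> complex \<Rightarrow> complex \<Rightarrow> complex" where
  "regprod m \<epsilon> x y = (THE F. is_regprod_continuation m \<epsilon> F) (x, y)"

end

theory Submission
  imports Defs
begin

text \<open>Write \<open>\<zeta>(s) = \<Sum>k. (k + x)\<^sup>-\<^sup>s\<close> for the Hurwitz zeta function with parameter \<open>x > 0\<close>.  For real \<open>w\<close> with
\<open>\<bar>w\<bar> < x\<^sup>m\<close> the binomial series gives

  \<open>\<Sum>k. ((k + x)\<^sup>m - w)\<^sup>-\<^sup>s = \<Sum>j. ((- s) gchoose j) (- w)\<^sup>j \<zeta>(m s + m j)\<close>,

and the right-hand side converges locally uniformly off the poles of its terms, so it continues the
left-hand side to the whole plane.  All terms with \<open>j \<ge> 1\<close> have a factor \<open>s\<close>.  For \<open>m \<ge> 2\<close> no argument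
\<open>m j\<close> with \<open>j \<ge> 1\<close> hits the pole of \<open>\<zeta>\<close> at \<open>1\<close>, so the derivative at \<open>0\<close> is

  \<open>m \<zeta>'(0) + \<Sum>j\<ge>1. w\<^sup>j / j * \<zeta>(m j) = m \<zeta>'(0) - \<Sum>k. ln (1 - w / (k + x)\<^sup>m)\<close>,

and the regularized product of \<open>(k + x)\<^sup>m - w\<close> is \<open>L(x)\<^sup>m * (\<Prod>k. 1 - w / (k + x)\<^sup>m)\<close>.  For \<open>m = 1\<close> the term
\<open>j = 1\<close> does meet the pole and contributes a multiple of \<open>w\<close> instead of a divergent series.  Both cases are
\<open>has_zeta_regprod_shifted_powers\<close>.

The case \<open>m = 1\<close> determines \<open>L\<close>.  The regularized product of \<open>k + (x - w)\<close> is an exponential of an affine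
function of \<open>w\<close> times the product of \<open>(1 - w / (k + x)) exp (w / (k + x))\<close>, which is Weierstrass' product
for \<open>1 / \<Gamma>(x - w)\<close>.  Hence \<open>L(z) = exp (A + B z) / \<Gamma>(z)\<close> with constants \<open>A\<close>, \<open>B\<close>
(\<open>has_zeta_regprod_arith\<close>); by Lerch's formula \<open>A = ln (2 \<pi>) / 2\<close> and \<open>B = 0\<close>.  The exponential is
compatible with the product formula whatever \<open>A\<close> and \<open>B\<close> are, because \<open>\<Prod>\<xi>. exp (A + B (x - \<xi> \<rho> y)) = exp (A + B x)\<^sup>m\<close>: the \<open>m\<close>-th roots of unity \<open>\<xi>\<close> sum to zero.
For the same reason Euler's limit formula gives
\<open>\<Prod>\<xi>. 1 / \<Gamma>(x - \<xi> z) = 1 / \<Gamma>(x)\<^sup>m * (\<Prod>k. 1 - z\<^sup>m / (k + x)\<^sup>m)\<close> (\<open>prod_rGamma_roots_unity\<close>).  With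
\<open>z = \<rho> y\<close> and \<open>w = z\<^sup>m = \<epsilon> y\<^sup>m\<close> this is the asserted formula for real \<open>0 \<le> y < x\<close>
(\<open>has_zeta_regprod_power_diff\<close>).  The identity theorem, applied in each variable, carries it over to
complex \<open>x\<close> and \<open>y\<close>.

The continuation of \<open>\<zeta>\<close> itself comes from an expansion of the same kind: the telescoping sum of
\<open>(k + 1 + x)\<^sup>1\<^sup>-\<^sup>s - (k + x)\<^sup>1\<^sup>-\<^sup>s\<close> expresses \<open>\<zeta>(s)\<close> by \<open>\<zeta>(s + 1), \<zeta>(s + 2), \<dots>\<close>
(\<open>hurwitz_sum_recurrence\<close>), which extends it to the left strip by strip.\<close>

section \<open>Series of holomorphic functions and double series\<close>

lemma holomorphic_on_suminf:
  fixes f :: "nat \<Rightarrow> complex \<Rightarrow> complex"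
  assumes "open S" and hol: "\<And>j. f j holomorphic_on S"
    and loc: "\<And>z. z \<in> S \<Longrightarrow> \<exists>U M. open U \<and> z \<in> U \<and> summable M \<and>
               (\<forall>\<^sub>F j in sequentially. \<forall>w\<in>U. norm (f j w) \<le> M j)"
  shows "(\<lambda>z. \<Sum>j. f j z) holomorphic_on S"
proof (rule holomorphic_uniform_sequence[OF \<open>open S\<close>])
  show "(\<lambda>z. \<Sum>j<n. f j z) holomorphic_on S" for n
    by (intro holomorphic_intros hol)
  fix z assume z: "z \<in> S"
  obtain U M where U: "open U" "z \<in> U" "summable M"
    and M: "\<forall>\<^sub>F j in sequentially. \<forall>w\<in>U. norm (f j w) \<le> M j"
    using loc[OF z] by blast
  obtain d where d: "d > 0" "cball z d \<subseteq> U \<inter> S"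
    using open_contains_cball[of "U \<inter> S"] U z \<open>open S\<close> by blast
  have "uniform_limit (cball z d) (\<lambda>n z. \<Sum>j<n. f j z) (\<lambda>z. \<Sum>j. f j z) sequentially"
    by (rule Weierstrass_m_test_ev[OF _ \<open>summable M\<close>]) (use M d in \<open>auto elim!: eventually_mono\<close>)
  with d show "\<exists>d>0. cball z d \<subseteq> S \<and>
      uniform_limit (cball z d) (\<lambda>n z. \<Sum>j<n. f j z) (\<lambda>z. \<Sum>j. f j z) sequentially"
    by blast
qed

text \<open>The double series to be interchanged below have terms \<open>c\<^sub>j (k + x)\<^sup>-\<^sup>a\<^sup>-\<^sup>m\<^sup>j\<close>.  As
\<open>(k + x)\<^sup>-\<^sup>m\<^sup>j \<le> x\<^sup>-\<^sup>m\<^sup>j\<close>, they are dominated by the products of the terms of a convergent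
series in \<open>j\<close> with those of a convergent series in \<open>k\<close>.\<close>

lemma
  fixes f :: "nat \<Rightarrow> nat \<Rightarrow> complex"
  assumes bound: "\<And>j k. norm (f j k) \<le> A j * B k" and A: "summable A" and B: "summable B"
    and nonneg: "\<And>j. 0 \<le> A j" "\<And>k. 0 \<le> B k"
  shows suminf_swap_dominated: "(\<Sum>j. \<Sum>k. f j k) = (\<Sum>k. \<Sum>j. f j k)"
    and summable_norm_suminf_dominated: "summable (\<lambda>k. norm (\<Sum>j. f j k))"
    and summable_suminf_dominated: "summable (\<lambda>k. \<Sum>j. f j k)"
proof -
  have A': "(\<lambda>j. norm (A j)) summable_on UNIV" and B': "(\<lambda>j. norm (B j)) summable_on UNIV"
    using A B nonneg by (auto intro!: summable_nonneg_imp_summable_on)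
  have sA: "summable (\<lambda>j. norm (f j k))" for k
    by (rule summable_comparison_test'[of "\<lambda>j. A j * B k" 0]) (use A bound in \<open>auto intro: summable_mult2\<close>)
  have sB: "summable (\<lambda>k. norm (f j k))" for j
    by (rule summable_comparison_test'[of "\<lambda>k. A j * B k" 0]) (use B bound in \<open>auto intro: summable_mult\<close>)
  have "(\<lambda>p. norm (case p of (j,k) \<Rightarrow> A j * B k)) summable_on UNIV \<times> UNIV"
    by (subst Infinite_Sum.abs_summable_on_Sigma_iff)
       (use A' B' in \<open>auto simp: abs_mult infsum_cmult_right'
          intro!: summable_on_cmult_right summable_on_cmult_left\<close>)
  hence "(\<lambda>p. norm (case p of (j,k) \<Rightarrow> f j k)) summable_on UNIV \<times> UNIV"
    by (rule Infinite_Sum.abs_summable_on_comparison_test)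
       (use bound nonneg in \<open>auto simp: abs_mult\<close>)
  hence sum: "(\<lambda>(j,k). f j k) summable_on UNIV \<times> UNIV"
    by (rule abs_summable_summable)
  have eqA: "(\<Sum>\<^sub>\<infinity>j. f j k) = (\<Sum>j. f j k)" for k
    using norm_summable_imp_has_sum[OF sA summable_sums[OF summable_norm_cancel[OF sA]]]
    by (rule infsumI)
  have eqB: "(\<Sum>\<^sub>\<infinity>k. f j k) = (\<Sum>k. f j k)" for j
    using norm_summable_imp_has_sum[OF sB summable_sums[OF summable_norm_cancel[OF sB]]]
    by (rule infsumI)
  have "norm (\<Sum>j. f j k) \<le> suminf A * B k" for k
  proof -
    have "norm (\<Sum>j. f j k) \<le> (\<Sum>j. A j * B k)"
      by (rule norm_suminf_le) (use bound A in \<open>auto intro: summable_mult2\<close>)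
    thus ?thesis using suminf_mult2[OF A, of "B k"] by simp
  qed
  thus nA: "summable (\<lambda>k. norm (\<Sum>j. f j k))"
    by (intro summable_comparison_test'[OF summable_mult[OF B, of "suminf A"], of 0]) auto
  thus "summable (\<lambda>k. \<Sum>j. f j k)"
    by (rule summable_norm_cancel)
  have "norm (\<Sum>k. f j k) \<le> A j * suminf B" for j
  proof -
    have "norm (\<Sum>k. f j k) \<le> (\<Sum>k. A j * B k)"
      by (rule norm_suminf_le) (use bound B in \<open>auto intro: summable_mult\<close>)
    thus ?thesis using suminf_mult[OF B, of "A j"] by simp
  qed
  hence nB: "summable (\<lambda>j. norm (\<Sum>k. f j k))"
    by (intro summable_comparison_test'[OF summable_mult2[OF A, of "suminf B"], of 0]) auto
  have "(\<Sum>\<^sub>\<infinity>j. \<Sum>\<^sub>\<infinity>k. f j k) = (\<Sum>\<^sub>\<infinity>k. \<Sum>\<^sub>\<infinity>j. f j k)"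
    using sum by (rule infsum_swap_banach)
  moreover have "(\<Sum>\<^sub>\<infinity>j. \<Sum>k. f j k) = (\<Sum>j. \<Sum>k. f j k)"
    using norm_summable_imp_has_sum[OF nB summable_sums[OF summable_norm_cancel[OF nB]]]
    by (rule infsumI)
  moreover have "(\<Sum>\<^sub>\<infinity>k. \<Sum>j. f j k) = (\<Sum>k. \<Sum>j. f j k)"
    using norm_summable_imp_has_sum[OF nA summable_sums[OF summable_norm_cancel[OF nA]]]
    by (rule infsumI)
  ultimately show "(\<Sum>j. \<Sum>k. f j k) = (\<Sum>k. \<Sum>j. f j k)"
    by (simp add: eqA eqB)
qed

text \<open>These are the coefficients of \<open>(1 - q)\<^sup>-\<^sup>R\<close>.  They dominate the binomial coefficients
\<open>a gchoose j\<close> uniformly in the disc of radius \<open>R\<close>, and their power series still has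
radius of convergence \<open>1\<close>.\<close>

definition binomial_bound :: "real \<Rightarrow> nat \<Rightarrow> real" where
  "binomial_bound R j = pochhammer R j / fact j"

lemma binomial_bound_nonneg: "0 \<le> R \<Longrightarrow> 0 \<le> binomial_bound R j"
  unfolding binomial_bound_def by (auto simp: pochhammer_prod intro!: prod_nonneg divide_nonneg_nonneg)

lemma norm_gbinomial_le:
  fixes a :: complex
  assumes "norm a \<le> R"
  shows "norm (a gchoose j) \<le> binomial_bound R j"
proof -
  have "norm (pochhammer (-a) j) \<le> pochhammer R j"
    unfolding pochhammer_prod prod_norm[symmetric]
  proof (intro prod_mono conjI norm_ge_zero)
    fix i show "norm (-a + of_nat i) \<le> R + of_nat i"
      using norm_triangle_ineq[of "-a" "of_nat i"] assms by simp
  qed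
  thus ?thesis
    by (simp add: gbinomial_pochhammer binomial_bound_def norm_mult norm_divide norm_power
        divide_right_mono)
qed

lemma summable_binomial_bound:
  assumes "0 \<le> q" "q < 1"
  shows "summable (\<lambda>j. binomial_bound R j * q ^ j)"
proof -
  have "(\<lambda>j. ((-R) gchoose j) * (-q) ^ j) sums (1 + (-q)) powr (-R)"
    by (rule gen_binomial_real) (use assms in auto)
  moreover have "((-R) gchoose j) * (-q) ^ j = binomial_bound R j * q ^ j" for j
    unfolding gbinomial_pochhammer binomial_bound_def power_minus[of q]
    by (simp add: power_mult_distrib[symmetric] mult_ac)
  ultimately show ?thesis by (simp add: sums_iff)
qed

section \<open>The Hurwitz zeta function\<close>

text \<open>The Dirichlet series of the Hurwitz zeta function, meaningful for \<open>Re s > 1\<close> only.  Its continuation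
is always carried along as an entire function \<open>G\<close> that agrees with \<open>(s - 1) * hurwitz_sum x s\<close>
in that half-plane; the factor \<open>s - 1\<close> removes the only pole.\<close>

definition hurwitz_sum :: "real \<Rightarrow> complex \<Rightarrow> complex" where
  "hurwitz_sum x s = (\<Sum>k. of_real (real k + x) powr (-s))"

lemma norm_shift_powr:
  "0 < x \<Longrightarrow> norm (of_real (real k + x) powr s :: complex) = (real k + x) powr Re s"
  using norm_powr_real_powr[of "of_real (real k + x)" s] by simp

lemma summable_shift_powr:
  assumes "0 < x" "1 < \<sigma>"
  shows "summable (\<lambda>k. (real k + x) powr (-\<sigma>))"
proof (rule summable_comparison_test')
  show "summable (\<lambda>k. real k powr (-\<sigma>))"
    using assms by (simp add: summable_real_powr_iff)
  show "norm ((real k + x) powr - \<sigma>) \<le> real k powr - \<sigma>" if "k \<ge> 1" for k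
    using assms that by (auto intro!: powr_mono2')
qed

lemma summable_hurwitz_sum:
  assumes "0 < x" "1 < Re s"
  shows "summable (\<lambda>k. norm (of_real (real k + x) powr (-s) :: complex))"
  using summable_shift_powr[OF assms] assms by (simp add: norm_shift_powr del: of_real_add)

text \<open>Comparison with the series at \<open>2\<close>: all terms have base at least \<open>x\<close>.  The resulting
factor \<open>x powr (- Re s)\<close> is what makes series in the shifts \<open>s + j\<close> converge.\<close>

lemma norm_hurwitz_sum_le:
  assumes "0 < x" "2 \<le> Re s"
  shows "norm (hurwitz_sum x s) \<le> (\<Sum>k. (real k + x) powr (-2)) * x powr (2 - Re s)"
proof -
  have s2: "summable (\<lambda>k. (real k + x) powr (-2))"
    by (rule summable_shift_powr) (use assms in auto)
  have "norm (hurwitz_sum x s) \<le> (\<Sum>k. (real k + x) powr (-2) * x powr (2 - Re s))"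
    unfolding hurwitz_sum_def
  proof (rule norm_suminf_le)
    fix k
    have "(real k + x) powr (- Re s) = (real k + x) powr (-2) * (real k + x) powr (2 - Re s)"
      by (simp add: powr_add[symmetric])
    also have "\<dots> \<le> (real k + x) powr (-2) * x powr (2 - Re s)"
      using assms by (intro mult_left_mono powr_mono2') auto
    finally show "norm (of_real (real k + x) powr (- s) :: complex) \<le> (real k + x) powr (-2) * x powr (2 - Re s)"
      using assms by (simp add: norm_shift_powr del: of_real_add)
  qed (use s2 in \<open>auto intro: summable_mult2\<close>)
  thus ?thesis using suminf_mult2[OF s2, of "x powr (2 - Re s)"] by simp
qed

text \<open>For \<open>x > 1\<close> every base exceeds \<open>1\<close>, so the terms decrease with \<open>Re s\<close> and a single real exponent
dominates a whole half-plane.\<close>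

lemma holomorphic_hurwitz_sum:
  assumes "1 < x"
  shows "hurwitz_sum x holomorphic_on {s. Re s > 1}"
proof -
  have "(\<lambda>s. \<Sum>k. of_real (real k + x) powr (-s)) holomorphic_on {s. Re s > 1}"
  proof (rule holomorphic_on_suminf)
    show "open {s. Re s > 1}" by (rule open_halfspace_Re_gt)
    show "(\<lambda>s. of_real (real j + x) powr - s) holomorphic_on {s. 1 < Re s}" for j
      by (intro holomorphic_intros)
    fix z assume "z \<in> {s. 1 < Re s}"
    hence z: "1 < Re z" by simp
    define \<sigma> where "\<sigma> = (1 + Re z) / 2"
    have \<sigma>: "1 < \<sigma>" "\<sigma> < Re z" using z by (auto simp: \<sigma>_def)
    have "norm (of_real (real j + x) powr - w :: complex) \<le> (real j + x) powr (-\<sigma>)"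
      if "Re w > \<sigma>" for j w
      using that assms by (subst norm_shift_powr) (auto intro!: powr_mono)
    with \<sigma> assms show "\<exists>U M. open U \<and> z \<in> U \<and> summable M \<and>
         (\<forall>\<^sub>F j in sequentially. \<forall>w\<in>U. norm (of_real (real j + x) powr - w :: complex) \<le> M j)"
      by (intro exI[of _ "{s. Re s > \<sigma>}"] exI[of _ "\<lambda>j. (real j + x) powr (-\<sigma>)"])
         (auto intro: summable_shift_powr open_halfspace_Re_gt)
  qed
  thus ?thesis by (simp add: hurwitz_sum_def[abs_def])
qed

text \<open>Summing the differences \<open>(k + 1 + x)\<^sup>1\<^sup>-\<^sup>s - (k + x)\<^sup>1\<^sup>-\<^sup>s\<close> over \<open>k\<close> telescopes to \<open>- x\<^sup>1\<^sup>-\<^sup>s\<close>.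
Expanding each of them by the binomial series, which converges because \<open>k + x > 1\<close>, produces
\<open>(1 - s) (k + x)\<^sup>-\<^sup>s\<close> and then the powers with exponents \<open>- s - 1, - s - 2, \<dots>\<close>.  So the zeta
function at \<open>s\<close> is expressed by its values to the right of \<open>s\<close>.  The identity
\<open>((1 - s) gchoose (i + 2)) = - ((1 - s) gchoose (i + 1)) (s + i) / (i + 2)\<close> brings every value into
the form \<open>(s - 1) * hurwitz_sum x s\<close> at a shifted argument, so that only pole-free functions occur.\<close>

lemma hurwitz_sum_recurrence:
  assumes x: "1 < x" and s: "1 < Re s"
  shows "(s - 1) * hurwitz_sum x s =
         of_real x powr (1 - s) -
         (\<Sum>i. ((1 - s) gchoose Suc i) / of_nat (i + 2) *
               ((s + of_nat i) * hurwitz_sum x (s + of_nat (Suc i))))"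
proof -
  let ?c = "\<lambda>j. (1 - s) gchoose j"
  define f where "f i k = ?c (i + 2) * of_real (real k + x) powr (- (s + of_nat (Suc i)))" for i k
  define A where "A i = binomial_bound (norm (1 - s)) (i + 2) * (1 / x) ^ (i + 2) * x" for i
  define B where "B k = (real k + x) powr (- Re s)" for k
  have bound: "norm (f i k) \<le> A i * B k" for i k
  proof -
    have "(real k + x) powr (- Re s - real (Suc i)) = B k * (real k + x) powr (- real (Suc i))"
      by (simp add: B_def powr_add[symmetric] del: of_nat_Suc)
    also have "\<dots> \<le> B k * x powr (- real (Suc i))"
      using x by (intro mult_left_mono powr_mono2') (auto simp: B_def)
    also have "x powr (- real (Suc i)) = (1 / x) ^ (i + 2) * x"
      using x by (simp only: powr_minus powr_realpow) (simp add: field_simps)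
    finally have "(real k + x) powr (- Re s - real (Suc i)) \<le> B k * ((1 / x) ^ (i + 2) * x)" .
    moreover have e: "Re (- (s + of_nat (Suc i))) = - Re s - real (Suc i)"
      by simp
    have "norm (of_real (real k + x) powr (- (s + of_nat (Suc i))) :: complex) =
        (real k + x) powr (- Re s - real (Suc i))"
      unfolding e[symmetric] by (rule norm_shift_powr) (use x in simp)
    ultimately have "norm (of_real (real k + x) powr (- (s + of_nat (Suc i))) :: complex)
        \<le> B k * ((1 / x) ^ (i + 2) * x)"
      by (simp only:)
    hence "norm (f i k) \<le> binomial_bound (norm (1 - s)) (i + 2) * (B k * ((1 / x) ^ (i + 2) * x))"
      unfolding f_def norm_mult using x
      by (intro mult_mono norm_gbinomial_le) (auto simp: binomial_bound_nonneg)
    thus ?thesis by (simp only: A_def mult_ac)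
  qed
  have "summable (\<lambda>i. binomial_bound (norm (1 - s)) (i + 2) * (1 / x) ^ (i + 2))"
    by (rule summable_ignore_initial_segment[OF summable_binomial_bound]) (use x in auto)
  hence sA: "summable A"
    unfolding A_def by (rule summable_mult2)
  have sB: "summable B"
    unfolding B_def using x s by (intro summable_shift_powr) auto
  have nn: "0 \<le> A i" "0 \<le> B k" for i k
    using x by (auto simp: A_def B_def binomial_bound_nonneg)
  have col: "(\<Sum>i. f i k) = (of_real (real (Suc k) + x) powr (1 - s) - of_real (real k + x) powr (1 - s))
               + (s - 1) * of_real (real k + x) powr (-s)" for k
  proof -
    have "(\<lambda>n. ?c n * of_real 1 ^ n * of_real (real k + x) powr (1 - s - of_nat n)) sums
            of_real (1 + (real k + x)) powr (1 - s)"
      by (rule gen_binomial_complex') (use x in auto)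
    from sums_split_initial_segment[OF this, of 2]
    have "(\<lambda>i. f i k) sums (of_real (1 + (real k + x)) powr (1 - s) -
        (\<Sum>n<2. ?c n * of_real 1 ^ n * of_real (real k + x) powr (1 - s - of_nat n)))"
      by (simp add: f_def algebra_simps)
    thus ?thesis
      by (simp add: sums_iff numeral_2_eq_2 algebra_simps)
  qed
  have tele: "(\<lambda>k. of_real (real (Suc k) + x) powr (1 - s) - of_real (real k + x) powr (1 - s) :: complex)
                sums (0 - of_real (real 0 + x) powr (1 - s))"
  proof (rule telescope_sums)
    have "(\<lambda>k. (real k + x) powr Re (1 - s)) \<longlonglongrightarrow> 0"
      using s filterlim_tendsto_add_at_top[OF tendsto_const[of x] filterlim_real_sequentially]
      by (intro tendsto_neg_powr) (auto simp: add.commute)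
    thus "(\<lambda>k. of_real (real k + x) powr (1 - s) :: complex) \<longlonglongrightarrow> 0"
      using x by (intro tendsto_norm_zero_cancel[where f = "\<lambda>k. of_real (real k + x) powr (1 - s)"])
        (simp add: norm_shift_powr del: of_real_add)
  qed
  have hs: "(\<lambda>k. of_real (real k + x) powr (-s)) sums hurwitz_sum x s"
    unfolding hurwitz_sum_def using x s
    by (intro summable_sums summable_norm_cancel[OF summable_hurwitz_sum]) auto
  have "(\<Sum>k. \<Sum>i. f i k) = - (of_real x powr (1 - s)) + (s - 1) * hurwitz_sum x s"
    using sums_add[OF tele sums_mult[OF hs, of "s - 1"]] unfolding col
    by (simp add: sums_iff)
  moreover have row: "(\<Sum>k. f i k) = - (?c (Suc i) / of_nat (i + 2) *
               ((s + of_nat i) * hurwitz_sum x (s + of_nat (Suc i))))" for i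
  proof -
    have "(\<lambda>k. of_real (real k + x) powr (- (s + of_nat (Suc i)))) sums hurwitz_sum x (s + of_nat (Suc i))"
      unfolding hurwitz_sum_def using x s
      by (intro summable_sums summable_norm_cancel[OF summable_hurwitz_sum]) auto
    from sums_mult[OF this, of "?c (i + 2)"]
    have "(\<Sum>k. f i k) = ?c (i + 2) * hurwitz_sum x (s + of_nat (Suc i))"
      by (simp add: f_def sums_iff)
    also have "?c (i + 2) = - (?c (Suc i) / of_nat (i + 2) * (s + of_nat i))"
    proof -
      have "of_nat (i + 2) * ?c (i + 2) = (1 - s - of_nat (Suc i)) * ?c (Suc i)"
        using gbinomial_absorb_comp[of "1 - s" "Suc i"] gbinomial_absorption[of "Suc i" "1 - s"]
        by (simp add: mult_ac)
      thus ?thesis by (simp add: field_simps del: of_nat_Suc of_nat_add)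
          (simp add: algebra_simps eq_neg_iff_add_eq_0)
    qed
    finally show ?thesis by simp
  qed
  ultimately have "- (of_real x powr (1 - s)) + (s - 1) * hurwitz_sum x s = (\<Sum>i. \<Sum>k. f i k)"
    using suminf_swap_dominated[OF bound sA sB nn] by simp
  also have "\<dots> = - (\<Sum>i. ((1 - s) gchoose Suc i) / of_nat (i + 2) *
               ((s + of_nat i) * hurwitz_sum x (s + of_nat (Suc i))))"
    unfolding row
  proof (rule suminf_minus)
    have "norm (f i k) \<le> B k * A i" for i k using bound[of i k] by (simp only: mult.commute)
    from summable_suminf_dominated[of "\<lambda>k i. f i k", OF this sB sA nn(2,1)]
    have "summable (\<lambda>i. \<Sum>k. f i k)" .
    thus "summable (\<lambda>i. ((1 - s) gchoose Suc i) / of_nat (i + 2) *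
               ((s + of_nat i) * hurwitz_sum x (s + of_nat (Suc i))))"
      unfolding row by (subst (asm) summable_minus_iff)
  qed
  finally show ?thesis by (simp add: algebra_simps)
qed

section \<open>Continuation of the Hurwitz zeta function\<close>

text \<open>The right-hand side of the recurrence involves the function at \<open>s + 1, s + 2, \<dots>\<close> only, so it makes
sense one unit further to the left.  All but finitely many of these arguments lie in the half-plane
\<open>Re s \<ge> 2\<close>, where the comparison with the series at \<open>2\<close> applies; hence the series converges locally uniformly.\<close>

lemma hurwitz_extend_strip:
  assumes x: "1 < x"
    and hol: "H holomorphic_on {s. Re s > a}"
    and H: "\<And>s. Re s > 1 \<Longrightarrow> H s = (s - 1) * hurwitz_sum x s"
  obtains H' where "H' holomorphic_on {s. Re s > a - 1}"
    "\<And>s. Re s > 1 \<Longrightarrow> H' s = (s - 1) * hurwitz_sum x s"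
proof -
  define f where "f i s = ((1 - s) gchoose Suc i) / of_nat (i + 2) * H (s + of_nat (Suc i))"
    for i s
  have "(\<lambda>s. \<Sum>i. f i s) holomorphic_on {s. Re s > a - 1}"
  proof (rule holomorphic_on_suminf)
    show "open {s. a - 1 < Re s}" by (rule open_halfspace_Re_gt)
    show "f i holomorphic_on {s. a - 1 < Re s}" for i
    proof -
      have 1: "(H \<circ> (\<lambda>s. s + of_nat (Suc i))) holomorphic_on {s. a - 1 < Re s}"
        by (rule holomorphic_on_compose_gen[OF _ hol]) (auto intro!: holomorphic_intros)
      have 2: "(\<lambda>s. (1 - s) gchoose Suc i) holomorphic_on {s. a - 1 < Re s}"
        by (intro analytic_imp_holomorphic analytic_intros)
      show ?thesis
        using holomorphic_on_mult[OF holomorphic_on_divide[OF 2 holomorphic_on_const[of "of_nat (i + 2)"]] 1]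
        unfolding f_def[abs_def] o_def of_nat_eq_0_iff by simp
    qed
    fix s0 assume "s0 \<in> {s. a - 1 < Re s}"
    define R where "R = norm s0 + 1"
    have R: "R \<ge> 1" by (simp add: R_def)
    define K where "K = (\<Sum>k. (real k + x) powr (-2))"
    have K: "K \<ge> 0"
      unfolding K_def by (intro suminf_nonneg summable_shift_powr) (use x in auto)
    define M where "M i = binomial_bound (R + 1) (Suc i) * (1 / x) ^ Suc i *
                           ((R + 1) * (K * x powr (R + 2)))" for i
    have "norm (f i s) \<le> M i" if s: "s \<in> ball s0 1" and i: "real i \<ge> R + 1" for i s
    proof -
      have ns: "norm s \<le> R"
        using s norm_triangle_ineq2[of s s0] by (simp add: R_def dist_norm norm_minus_commute)
      hence Re: "- R \<le> Re s" using abs_Re_le_cmod[of s] by linarith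
      have n1: "norm (1 - s) \<le> R + 1"
        using ns norm_triangle_ineq4[of 1 s] by simp
      have Re2: "Re (s + of_nat (Suc i)) \<ge> 2" using Re i by simp
      have "norm (s + of_nat i) / (real i + 2) \<le> R + 1"
      proof -
        have "norm (s + of_nat i) \<le> R + real i"
          using norm_triangle_ineq[of s "of_nat i"] ns by simp
        also have "\<dots> \<le> (R + 1) * (real i + 2)" using R by (simp add: algebra_simps)
        finally show ?thesis by (simp add: field_simps)
      qed
      moreover have h: "norm (hurwitz_sum x (s + of_nat (Suc i))) \<le> K * x powr (2 - Re (s + of_nat (Suc i)))"
        unfolding K_def by (rule norm_hurwitz_sum_le) (use x Re2 in auto)
      have p: "x powr (2 - Re (s + of_nat (Suc i))) \<le> x powr (R + 2) * (1 / x) ^ Suc i"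
      proof -
        have "x powr (2 - Re (s + of_nat (Suc i))) \<le> x powr ((R + 2) + - real (Suc i))"
          using x Re by (intro powr_mono) auto
        also have "\<dots> = x powr (R + 2) * (1 / x) ^ Suc i"
          using x by (simp only: powr_add powr_minus powr_realpow) (simp add: field_simps)
        finally show ?thesis .
      qed
      moreover have "norm (hurwitz_sum x (s + of_nat (Suc i))) \<le> K * (x powr (R + 2) * (1 / x) ^ Suc i)"
        by (rule order_trans[OF h mult_left_mono[OF p K]])
      ultimately have "norm (s + of_nat i) / (real i + 2) * norm (hurwitz_sum x (s + of_nat (Suc i)))
          \<le> (R + 1) * (K * (x powr (R + 2) * (1 / x) ^ Suc i))"
        using R by (intro mult_mono) auto
      hence "norm ((1 - s) gchoose Suc i) * (norm (s + of_nat i) / (real i + 2) * norm (hurwitz_sum x (s + of_nat (Suc i))))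
          \<le> binomial_bound (R + 1) (Suc i) * ((R + 1) * (K * (x powr (R + 2) * (1 / x) ^ Suc i)))"
        using R by (intro mult_mono[OF norm_gbinomial_le[OF n1]] binomial_bound_nonneg) auto
      moreover have "norm (of_nat (i + 2) :: complex) = real i + 2"
        unfolding norm_of_nat by simp
      ultimately show ?thesis
        using H[of "s + of_nat (Suc i)"] Re2
        unfolding f_def M_def norm_mult norm_divide by (simp add: norm_mult mult_ac)
    qed
    moreover have "summable M"
    proof -
      have "summable (\<lambda>i. binomial_bound (R + 1) (i + 1) * (1 / x) ^ (i + 1))"
        by (rule summable_ignore_initial_segment[OF summable_binomial_bound]) (use x in auto)
      thus ?thesis unfolding M_def Suc_eq_plus1 by (rule summable_mult2)
    qed
    moreover have "\<forall>\<^sub>F i in sequentially. real i \<ge> R + 1"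
      by (metis eventually_at_top_linorder filterlim_at_top filterlim_real_sequentially)
    ultimately show "\<exists>U M. open U \<and> s0 \<in> U \<and> summable M \<and>
        (\<forall>\<^sub>F i in sequentially. \<forall>s\<in>U. norm (f i s) \<le> M i)"
      by (intro exI[of _ "ball s0 1"] exI[of _ M]) (auto elim!: eventually_mono)
  qed
  hence "(\<lambda>s. of_real x powr (1 - s) - (\<Sum>i. f i s)) holomorphic_on {s. Re s > a - 1}"
    by (intro holomorphic_intros)
  moreover have "of_real x powr (1 - s) - (\<Sum>i. f i s) = (s - 1) * hurwitz_sum x s" if "Re s > 1" for s
    unfolding hurwitz_sum_recurrence[OF x that] f_def using that by (simp add: H)
  ultimately show thesis using that by blast
qed

lemma hurwitz_continuation_gt1:
  assumes x: "1 < x"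
  obtains G where "G holomorphic_on UNIV" "\<And>s. Re s > 1 \<Longrightarrow> G s = (s - 1) * hurwitz_sum x s"
proof -
  have "\<exists>H. H holomorphic_on {s. Re s > 1 - real n} \<and>
            (\<forall>s. Re s > 1 \<longrightarrow> H s = (s - 1) * hurwitz_sum x s)" for n
  proof (induction n)
    case 0
    show ?case
      by (intro exI[of _ "\<lambda>s. (s - 1) * hurwitz_sum x s"])
         (use x in \<open>auto intro!: holomorphic_intros holomorphic_hurwitz_sum\<close>)
  next
    case (Suc n)
    then obtain H where "H holomorphic_on {s. Re s > 1 - real n}"
      "\<And>s. Re s > 1 \<Longrightarrow> H s = (s - 1) * hurwitz_sum x s" by blast
    from hurwitz_extend_strip[OF x this] obtain H' where
      "H' holomorphic_on {s. Re s > 1 - real n - 1}"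
      "\<And>s. Re s > 1 \<Longrightarrow> H' s = (s - 1) * hurwitz_sum x s" by auto
    thus ?case by (intro exI[of _ H']) (auto simp: algebra_simps)
  qed
  then obtain H where hol: "\<And>n. H n holomorphic_on {s. Re s > 1 - real n}"
    and H: "\<And>n s. Re s > 1 \<Longrightarrow> H n s = (s - 1) * hurwitz_sum x s" by metis
  have eq: "H m s = H n s" if "Re s > 1 - real m" "m \<le> n" for m n s
  proof (rule analytic_continuation_open[of "{s. Re s > 1}" "{s. Re s > 1 - real m}" "H m" "H n"])
    show "{s::complex. Re s > 1} \<noteq> {}" by (auto intro: exI[of _ 2])
    show "H n holomorphic_on {s. Re s > 1 - real m}"
      by (rule holomorphic_on_subset[OF hol]) (use that in auto)
  qed (use that hol H in \<open>auto simp: open_halfspace_Re_gt convex_halfspace_Re_gt convex_connected\<close>)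
  \<comment> \<open>Any index whose half-plane contains s gives the same value, by the identity theorem.\<close>
  define G where "G s = H (nat \<lceil>2 - Re s\<rceil>) s" for s
  have G: "G s = H n s" if "Re s > 1 - real n" for s n
  proof -
    have "Re s > 1 - real (nat \<lceil>2 - Re s\<rceil>)" by linarith
    with that show ?thesis
      unfolding G_def by (cases "n \<le> nat \<lceil>2 - Re s\<rceil>") (auto simp: eq[of n s] eq[of "nat \<lceil>2 - Re s\<rceil>" s n])
  qed
  have "G field_differentiable (at s)" for s
  proof -
    obtain n where n: "1 - Re s < real n" using reals_Archimedean2 by blast
    have "G holomorphic_on {s. Re s > 1 - real n}"
      using hol[of n] by (rule holomorphic_transform) (simp add: G)
    with n show ?thesis
      by (intro holomorphic_on_imp_differentiable_at[OF _ open_halfspace_Re_gt[of "1 - real n"]]) auto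
  qed
  hence "G holomorphic_on UNIV" by (simp add: holomorphic_on_def)
  moreover have "G s = (s - 1) * hurwitz_sum x s" if "Re s > 1" for s
    using G[of 0 s] H[of s 0] that by simp
  ultimately show thesis using that by blast
qed

text \<open>Splitting off the term \<open>k = 0\<close> replaces \<open>x\<close> by \<open>x + 1 > 1\<close> at the cost of an entire function.\<close>

lemma hurwitz_continuation:
  assumes x: "0 < x"
  obtains G where "G holomorphic_on UNIV" "\<And>s. Re s > 1 \<Longrightarrow> G s = (s - 1) * hurwitz_sum x s"
proof -
  obtain G where G: "G holomorphic_on UNIV" "\<And>s. Re s > 1 \<Longrightarrow> G s = (s - 1) * hurwitz_sum (x + 1) s"
    using hurwitz_continuation_gt1[of "x + 1"] x by auto
  have "hurwitz_sum x s = of_real x powr (-s) + hurwitz_sum (x + 1) s" if s: "Re s > 1" for s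
    unfolding hurwitz_sum_def
    using suminf_split_head[OF summable_norm_cancel[OF summable_hurwitz_sum[OF x s]]]
    by (simp add: algebra_simps)
  hence "(s - 1) * of_real x powr (-s) + G s = (s - 1) * hurwitz_sum x s" if "Re s > 1" for s
    using that G(2)[OF that] by (simp add: algebra_simps)
  moreover have "(\<lambda>s. (s - 1) * of_real x powr (-s) + G s) holomorphic_on UNIV"
    by (intro holomorphic_intros G)
  ultimately show thesis using that by blast
qed

section \<open>Dirichlet series over shifted powers\<close>

text \<open>For a continuation \<open>\<zeta>\<close> of the Hurwitz zeta function and \<open>s \<noteq> 0\<close>, this is \<open>1 / s\<close> times the term of index
\<open>j + 2\<close> of the expansion of \<open>\<Sum>k. ((k + x)\<^sup>m - w)\<^sup>-\<^sup>s\<close> in powers of \<open>w\<close>, namely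
\<open>((- s) gchoose (j + 2)) (- w)\<^sup>j\<^sup>+\<^sup>2 \<zeta> (m (s + j + 2))\<close>.  Having the factor \<open>s\<close> removed, the derivative of
the expansion at \<open>0\<close> can be read off from the value of the sum of these terms, without
differentiating a series.  The terms of index \<open>0\<close> and \<open>1\<close> are kept apart: index \<open>0\<close> has no factor \<open>s\<close>,
and for \<open>m = 1\<close> index \<open>1\<close> meets the pole of \<open>\<zeta>\<close> at \<open>s = 0\<close>.\<close>

definition tail_term :: "(complex \<Rightarrow> complex) \<Rightarrow> nat \<Rightarrow> real \<Rightarrow> nat \<Rightarrow> complex \<Rightarrow> complex" where
  "tail_term \<zeta> m w j s = - 1 / of_nat (j + 2) * ((- s - 1) gchoose (j + 1)) * of_real (- w) ^ (j + 2) *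
      \<zeta> (of_nat m * (s + of_nat (j + 2)))"

text \<open>Once \<open>j\<close> exceeds \<open>norm s0 + 1\<close> the argument \<open>m (s + j + 2)\<close> has real part at least \<open>2\<close> throughout the
disc, and the factor \<open>x powr (- m j)\<close> gained there turns \<open>w\<^sup>j\<close> into \<open>(w / x\<^sup>m)\<^sup>j\<close>, which beats the binomial
coefficients.\<close>

lemma tail_term_eventually_bounded:
  assumes x: "0 < x" and m: "m \<ge> 1" and w: "\<bar>w\<bar> < x ^ m"
    and \<zeta>: "\<And>s. Re s > 1 \<Longrightarrow> \<zeta> s = hurwitz_sum x s"
  obtains M where "summable M"
    "\<forall>\<^sub>F j in sequentially. \<forall>s\<in>ball s0 1. norm (tail_term \<zeta> m w j s) \<le> M j"
proof -
  define R where "R = norm s0 + 1"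
  have R: "R \<ge> 1" by (simp add: R_def)
  define K where "K = (\<Sum>k. (real k + x) powr (-2))"
  have K: "K \<ge> 0"
    unfolding K_def by (intro suminf_nonneg summable_shift_powr) (use x in auto)
  define q where "q = \<bar>w\<bar> / x ^ m"
  have q: "0 \<le> q" "q < 1" using w x by (auto simp: q_def)
  \<comment> \<open>The exponential bounds x powr (- m Re s) in the disc, whether or not x is below 1.\<close>
  define C where "C = x ^ 2 * exp (real m * R * \<bar>ln x\<bar>)"
  have C: "C \<ge> 0" by (simp add: C_def)
  define M where "M j = binomial_bound (R + 1) (j + 1) * q ^ (j + 1) * (q * K * C)" for j
  have bound: "norm (tail_term \<zeta> m w j s) \<le> M j" if s: "s \<in> ball s0 1" and j: "real j \<ge> R" for s j
  proof -
    have ns: "norm s \<le> R"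
      using s norm_triangle_ineq2[of s s0] by (simp add: R_def dist_norm norm_minus_commute)
    hence Re: "\<bar>Re s\<bar> \<le> R" using abs_Re_le_cmod[of s] by linarith
    have n1: "norm (- s - 1) \<le> R + 1"
      using ns norm_triangle_ineq4[of "-s" 1] by simp
    let ?t = "of_nat m * (s + of_nat (j + 2)) :: complex"
    have Ret: "Re ?t = real m * Re s + real (m * (j + 2))" by (simp add: algebra_simps)
    have "1 * 2 \<le> real m * (Re s + real (j + 2))"
      using m Re j by (intro mult_mono) auto
    hence Re2: "Re ?t \<ge> 2" by simp
    have "norm (\<zeta> ?t) \<le> K * x powr (2 - Re ?t)"
      using norm_hurwitz_sum_le[OF x Re2] \<zeta>[of ?t] Re2 by (simp add: K_def)
    also have "x powr (2 - Re ?t) = x ^ 2 * (x powr (- real m * Re s)) * (1 / x ^ m) ^ (j + 2)"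
    proof -
      have "x powr (2 - Re ?t) = x powr (2 + - real m * Re s + - real (m * (j + 2)))"
        unfolding Ret by (simp add: algebra_simps)
      also have "\<dots> = x powr 2 * x powr (- real m * Re s) * x powr (- real (m * (j + 2)))"
        by (simp only: powr_add)
      also have "x powr (- real (m * (j + 2))) = (1 / x ^ m) ^ (j + 2)"
        using x by (simp only: powr_minus powr_realpow power_mult power_one_over inverse_eq_divide)
      also have "x powr 2 = x ^ 2"
        using x powr_realpow[of x 2] by simp
      finally show ?thesis .
    qed
    also have "K * (x ^ 2 * (x powr (- real m * Re s)) * (1 / x ^ m) ^ (j + 2)) \<le>
        K * (x ^ 2 * exp (real m * R * \<bar>ln x\<bar>) * (1 / x ^ m) ^ (j + 2))"
    proof (intro mult_left_mono[OF _ K] mult_right_mono mult_left_mono)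
      have "- real m * Re s * ln x \<le> \<bar>- real m * Re s * ln x\<bar>" by (rule abs_ge_self)
      also have "\<dots> = real m * \<bar>Re s\<bar> * \<bar>ln x\<bar>" by (simp add: abs_mult)
      also have "\<dots> \<le> real m * R * \<bar>ln x\<bar>"
        using Re by (intro mult_right_mono mult_left_mono) auto
      finally show "x powr (- real m * Re s) \<le> exp (real m * R * \<bar>ln x\<bar>)"
        using x by (simp add: powr_def)
    qed (use x in auto)
    finally have z: "norm (\<zeta> ?t) \<le> K * (C * (1 / x ^ m) ^ (j + 2))"
      unfolding C_def .
    have "norm (tail_term \<zeta> m w j s) =
        norm (- 1 / of_nat (j + 2) :: complex) * norm ((- s - 1) gchoose (j + 1)) * \<bar>w\<bar> ^ (j + 2) * norm (\<zeta> ?t)"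
      unfolding tail_term_def norm_mult norm_power by simp
    also have "\<dots> \<le> 1 * binomial_bound (R + 1) (j + 1) * \<bar>w\<bar> ^ (j + 2) * (K * (C * (1 / x ^ m) ^ (j + 2)))"
    proof (rule mult_mono[OF mult_right_mono[OF mult_mono] z])
      show "norm (- 1 / of_nat (j + 2) :: complex) \<le> 1"
        unfolding norm_divide norm_of_nat by simp
      show "norm ((- s - 1) gchoose (j + 1)) \<le> binomial_bound (R + 1) (j + 1)"
        by (rule norm_gbinomial_le[OF n1])
    qed (use R in \<open>auto intro!: binomial_bound_nonneg mult_nonneg_nonneg\<close>)
    also have "\<dots> = M j"
    proof -
      have "\<bar>w\<bar> ^ (j + 2) * (1 / x ^ m) ^ (j + 2) = q ^ (j + 1) * q"
        by (simp add: q_def power_mult_distrib[symmetric])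
      thus ?thesis by (simp only: M_def mult_1_left mult.assoc) (simp only: mult_ac)
    qed
    finally show ?thesis .
  qed
  have "summable M"
    unfolding M_def using summable_ignore_initial_segment[OF summable_binomial_bound[OF q], of _ 1]
    by (rule summable_mult2)
  moreover have "\<forall>\<^sub>F j in sequentially. real j \<ge> R"
    by (metis eventually_at_top_linorder filterlim_at_top filterlim_real_sequentially)
  hence "\<forall>\<^sub>F j in sequentially. \<forall>s\<in>ball s0 1. norm (tail_term \<zeta> m w j s) \<le> M j"
    by eventually_elim (use bound in blast)
  ultimately show thesis by (rule that)
qed

lemma holomorphic_tail:
  assumes x: "0 < x" and m: "m \<ge> 1" and w: "\<bar>w\<bar> < x ^ m"
    and \<zeta>: "\<And>s. Re s > 1 \<Longrightarrow> \<zeta> s = hurwitz_sum x s"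
    and hol: "\<And>j. tail_term \<zeta> m w j holomorphic_on S" and S: "open S"
  shows "(\<lambda>s. \<Sum>j. tail_term \<zeta> m w j s) holomorphic_on S"
proof (rule holomorphic_on_suminf[OF S hol])
  fix s0
  obtain M where "summable M"
    "\<forall>\<^sub>F j in sequentially. \<forall>s\<in>ball s0 1. norm (tail_term \<zeta> m w j s) \<le> M j"
    using tail_term_eventually_bounded[OF x m w \<zeta>] by blast
  thus "\<exists>U M. open U \<and> s0 \<in> U \<and> summable M \<and>
      (\<forall>\<^sub>F j in sequentially. \<forall>s\<in>U. norm (tail_term \<zeta> m w j s) \<le> M j)"
    by (intro exI[of _ "ball s0 1"] exI[of _ M]) auto
qed

text \<open>Near a given point only finitely many terms can have a pole; the remaining ones form a holomorphic
series.\<close>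

lemma meromorphic_tail:
  assumes x: "0 < x" and m: "m \<ge> 1" and w: "\<bar>w\<bar> < x ^ m"
    and \<zeta>: "\<And>s. Re s > 1 \<Longrightarrow> \<zeta> s = hurwitz_sum x s"
    and hol: "\<zeta> holomorphic_on UNIV - {1}" and mero: "\<zeta> meromorphic_on UNIV"
  shows "(\<lambda>s. \<Sum>j. tail_term \<zeta> m w j s) meromorphic_on UNIV"
proof (subst meromorphic_on_meromorphic_at, safe)
  fix s0 :: complex
  let ?t = "tail_term \<zeta> m w"
  obtain M where M: "summable M" "\<forall>\<^sub>F j in sequentially. \<forall>s\<in>ball s0 1. norm (?t j s) \<le> M j"
    using tail_term_eventually_bounded[OF x m w \<zeta>] by blast
  define J where "J = nat \<lceil>norm s0 + 2\<rceil>"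
  have J: "real J \<ge> norm s0 + 2" unfolding J_def by linarith
  have sum: "summable (\<lambda>j. ?t j s)" if "s \<in> ball s0 1" for s
    by (rule summable_comparison_test_ev[OF _ M(1)])
       (use M(2) that in \<open>auto elim: eventually_mono\<close>)
  have "(\<lambda>s. \<Sum>j. ?t (j + J) s) holomorphic_on ball s0 1"
  proof (rule holomorphic_on_suminf)
    show "?t (j + J) holomorphic_on ball s0 1" for j
    proof -
      have "of_nat m * (s + of_nat (j + J + 2)) \<in> UNIV - {1}" if s: "s \<in> ball s0 1" for s
      proof -
        have "norm s \<le> norm s0 + 1"
          using s norm_triangle_ineq2[of s s0] by (simp add: dist_norm norm_minus_commute)
        hence "\<bar>Re s\<bar> \<le> norm s0 + 1" using abs_Re_le_cmod[of s] by linarith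
        hence "1 * 2 \<le> real m * (Re s + real (j + J + 2))"
          using m J by (intro mult_mono) auto
        hence "Re (of_nat m * (s + of_nat (j + J + 2))) \<ge> 2" by simp
        moreover have "z \<in> UNIV - {1}" if "Re z \<ge> 2" for z :: complex using that by auto
        ultimately show ?thesis by blast
      qed
      hence 1: "(\<zeta> \<circ> (\<lambda>s. of_nat m * (s + of_nat (j + J + 2)))) holomorphic_on ball s0 1"
        by (intro holomorphic_on_compose_gen[OF _ hol] holomorphic_intros) auto
      have 2: "(\<lambda>s. (- s - 1) gchoose (j + J + 1)) holomorphic_on ball s0 1"
        by (intro analytic_imp_holomorphic analytic_intros)
      show ?thesis unfolding tail_term_def
        by (intro holomorphic_intros 1[unfolded o_def] 2)
    qed
    fix s assume s: "s \<in> ball s0 1"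
    have "\<forall>\<^sub>F j in sequentially. \<forall>s\<in>ball s0 1. norm (?t (j + J) s) \<le> M (j + J)"
      using M(2) by (subst (asm) eventually_sequentially_seg[of _ J, symmetric])
    with s M(1) show "\<exists>U N. open U \<and> s \<in> U \<and> summable N \<and>
        (\<forall>\<^sub>F j in sequentially. \<forall>s\<in>U. norm (?t (j + J) s) \<le> N j)"
      by (intro exI[of _ "ball s0 1"] exI[of _ "\<lambda>j. M (j + J)"])
         (auto simp: summable_iff_shift)
  qed auto
  hence "(\<lambda>s. \<Sum>j. ?t (j + J) s) meromorphic_on {s0}"
    by (intro analytic_on_imp_meromorphic_on)
       (auto simp: analytic_at intro!: exI[of _ "ball s0 1"])
  moreover have "?t j meromorphic_on {s0}" for j
  proof -
    have "(\<lambda>s. of_nat m * (s + of_nat (j + 2))) analytic_on {s0 :: complex}"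
      by (intro analytic_intros)
    hence 1: "(\<lambda>s. \<zeta> (of_nat m * (s + of_nat (j + 2)))) meromorphic_on {s0}"
      by (rule meromorphic_on_compose[OF mero]) auto
    have 2: "(\<lambda>s. (- s - 1) gchoose (j + 1)) meromorphic_on {s0}"
      by (intro analytic_on_imp_meromorphic_on analytic_intros)
    show ?thesis unfolding tail_term_def[abs_def] by (intro meromorphic_intros 1 2)
  qed
  ultimately have "(\<lambda>s. (\<Sum>j. ?t (j + J) s) + (\<Sum>j<J. ?t j s)) meromorphic_on {s0}"
    by (intro meromorphic_intros)
  moreover have "\<forall>\<^sub>F s in at s0. (\<Sum>j. ?t j s) = (\<Sum>j. ?t (j + J) s) + (\<Sum>j<J. ?t j s)"
  proof -
    have "\<forall>\<^sub>F s in at s0. s \<in> ball s0 1"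
      by (intro eventually_at_in_open') auto
    thus ?thesis
      by eventually_elim (rule suminf_split_initial_segment[OF sum])
  qed
  ultimately show "(\<lambda>s. \<Sum>j. ?t j s) meromorphic_on {s0}"
    by (subst meromorphic_on_cong) auto
qed

lemma gbinomial_minus_Suc_Suc:
  "((-s) gchoose (j + 2)) = (s :: complex) * (- 1 / of_nat (j + 2) * ((- s - 1) gchoose (j + 1)))"
proof -
  have divide: "b = s * (- 1 / n * c)" if "n * b = - s * c" "n \<noteq> 0" for n b c :: complex
    using that by (simp add: field_simps)
  show ?thesis
  proof (rule divide)
    show "of_nat (j + 2) * ((-s) gchoose (j + 2)) = - s * ((- s - 1) gchoose (j + 1))"
      using gbinomial_absorption[of "Suc j" "-s"]
      by (simp only: numeral_2_eq_2 add_Suc_right add_0_right One_nat_def)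
    show "of_nat (j + 2) \<noteq> (0::complex)" unfolding of_nat_eq_0_iff by simp
  qed
qed

text \<open>The binomial series in \<open>w / (k + x)\<^sup>m\<close>, followed by summation over \<open>k\<close> first.\<close>

lemma sum_shifted_powers_eq:
  assumes x: "0 < x" and m: "m \<ge> 1" and w: "\<bar>w\<bar> < x ^ m"
    and \<zeta>: "\<And>s. Re s > 1 \<Longrightarrow> \<zeta> s = hurwitz_sum x s" and s: "Re s > 1"
  shows "summable (\<lambda>k. norm (of_real ((real k + x) ^ m - w) powr (-s) :: complex))"
    and "(\<Sum>k. of_real ((real k + x) ^ m - w) powr (-s)) =
          \<zeta> (of_nat m * s) + s * of_real w * \<zeta> (of_nat m * s + of_nat m) +
          s * (\<Sum>j. tail_term \<zeta> m w j s)"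
proof -
  define f where "f j k = ((-s) gchoose j) * of_real (-w) ^ j *
    of_real (real k + x) powr (- (of_nat m * (s + of_nat j)))" for j k
  define q where "q = \<bar>w\<bar> / x ^ m"
  have q: "0 \<le> q" "q < 1" using w x by (auto simp: q_def)
  define A where "A j = binomial_bound (norm s) j * q ^ j" for j
  define B where "B k = (real k + x) powr (- (real m * Re s))" for k
  have "1 * Re s \<le> real m * Re s" using m s by (intro mult_right_mono) auto
  hence ms: "1 < real m * Re s" using s by linarith
  have bound: "norm (f j k) \<le> A j * B k" for j k
  proof -
    have "norm (of_real (real k + x) powr (- (of_nat m * (s + of_nat j))) :: complex) =
            (real k + x) powr (Re (- (of_nat m * (s + of_nat j))))"
      by (rule norm_shift_powr[OF x])
    also have "\<dots> = (real k + x) powr (- (real m * Re s) + - real (m * j))"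
      by (simp add: algebra_simps)
    also have "\<dots> = B k * (1 / (real k + x) ^ m) ^ j"
      unfolding powr_add B_def using x
      by (simp only: powr_minus powr_realpow add_nonneg_pos of_nat_0_le_iff power_mult power_one_over inverse_eq_divide)
    also have "\<dots> \<le> B k * (1 / x ^ m) ^ j"
      using x by (intro mult_left_mono power_mono divide_left_mono) (auto simp: B_def intro!: power_mono)
    finally have "norm (f j k) \<le> binomial_bound (norm s) j * \<bar>w\<bar> ^ j * (B k * (1 / x ^ m) ^ j)"
      unfolding f_def norm_mult norm_power
      by (intro mult_mono norm_gbinomial_le) (auto intro!: binomial_bound_nonneg mult_nonneg_nonneg)
    thus ?thesis by (simp add: A_def q_def power_divide)
  qed
  have sA: "summable A" unfolding A_def by (rule summable_binomial_bound[OF q])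
  have sB: "summable B" unfolding B_def by (rule summable_shift_powr[OF x ms])
  have nn: "0 \<le> A j" "0 \<le> B k" for j k using q by (auto simp: A_def B_def binomial_bound_nonneg)
  have col: "(\<Sum>j. f j k) = of_real ((real k + x) ^ m - w) powr (-s)" for k
  proof -
    have "x ^ m \<le> (real k + x) ^ m" using x by (intro power_mono) auto
    hence "(\<lambda>j. ((-s) gchoose j) * of_real (-w) ^ j * of_real ((real k + x) ^ m) powr (-s - of_nat j)) sums
            of_real (- w + (real k + x) ^ m) powr (-s)"
      using w by (intro gen_binomial_complex') auto
    moreover have "of_real ((real k + x) ^ m) powr (-s - of_nat j) =
        (of_real (real k + x) powr (- (of_nat m * (s + of_nat j))) :: complex)" for j
    proof -
      have "ln ((real k + x) ^ m) = real m * ln (real k + x)"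
        using x by (simp add: ln_realpow)
      thus ?thesis using x
        by (simp add: powr_def Ln_of_real algebra_simps del: of_real_power of_real_add)
    qed
    ultimately show ?thesis unfolding f_def by (simp add: sums_iff)
  qed
  show "summable (\<lambda>k. norm (of_real ((real k + x) ^ m - w) powr (-s) :: complex))"
    using summable_norm_suminf_dominated[OF bound sA sB nn] unfolding col .
  have row: "(\<Sum>k. f j k) = ((-s) gchoose j) * of_real (-w) ^ j * \<zeta> (of_nat m * (s + of_nat j))" for j
  proof -
    have "real m * Re s \<le> real m * (Re s + real j)" by (intro mult_left_mono) auto
    hence Re: "1 < Re (of_nat m * (s + of_nat j))" using ms by simp
    have "(\<lambda>k. of_real (real k + x) powr (- (of_nat m * (s + of_nat j)))) sums
        hurwitz_sum x (of_nat m * (s + of_nat j))"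
      unfolding hurwitz_sum_def
      by (intro summable_sums summable_norm_cancel[OF summable_hurwitz_sum[OF x Re]])
    from sums_mult[OF this, of "((-s) gchoose j) * of_real (-w) ^ j"]
    show ?thesis unfolding f_def \<zeta>[OF Re] by (simp add: sums_iff mult_ac)
  qed
  have sr: "summable (\<lambda>j. \<Sum>k. f j k)"
  proof -
    have "norm (f j k) \<le> B k * A j" for j k using bound[of j k] by (simp add: mult_ac)
    from summable_suminf_dominated[of "\<lambda>k j. f j k", OF this sB sA nn(2,1)]
    show ?thesis .
  qed
  have "(\<Sum>k. of_real ((real k + x) ^ m - w) powr (-s)) = (\<Sum>j. \<Sum>k. f j k)"
    using suminf_swap_dominated[OF bound sA sB nn] unfolding col by simp
  also have "\<dots> = (\<Sum>j. \<Sum>k. f (j + 2) k) + (\<Sum>j<2. \<Sum>k. f j k)"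
    by (rule suminf_split_initial_segment[OF sr])
  also have "(\<Sum>j. \<Sum>k. f (j + 2) k) = (\<Sum>j. s * tail_term \<zeta> m w j s)"
    unfolding row tail_term_def gbinomial_minus_Suc_Suc by (simp only: mult.assoc)
  also have "\<dots> = s * (\<Sum>j. tail_term \<zeta> m w j s)"
  proof (rule suminf_mult)
    have "summable (\<lambda>j. s * tail_term \<zeta> m w j s)"
      using summable_ignore_initial_segment[OF sr, of 2]
      unfolding row tail_term_def gbinomial_minus_Suc_Suc by (simp only: mult.assoc)
    moreover have "s \<noteq> 0" using s by auto
    ultimately show "summable (\<lambda>j. tail_term \<zeta> m w j s)" by (simp add: summable_cmult_iff)
  qed
  also have "(\<Sum>j<2. \<Sum>k. f j k) = \<zeta> (of_nat m * s) + s * of_real w * \<zeta> (of_nat m * s + of_nat m)"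
    unfolding row by (simp add: numeral_2_eq_2 algebra_simps)
  finally show "(\<Sum>k. of_real ((real k + x) ^ m - w) powr (-s)) =
          \<zeta> (of_nat m * s) + s * of_real w * \<zeta> (of_nat m * s + of_nat m) +
          s * (\<Sum>j. tail_term \<zeta> m w j s)" by simp
qed

section \<open>The derivative at the origin\<close>

text \<open>At \<open>s = 0\<close> the binomial coefficients become signs and the terms collapse to \<open>w\<^sup>j / j\<close> times
\<open>\<Sum>k. (k + x)\<^sup>-\<^sup>m\<^sup>j\<close> for \<open>j \<ge> 2\<close>.  Summed over \<open>j\<close> first, this is the logarithmic series without its
linear term.\<close>

lemma suminf_tail_term_0:
  assumes x: "0 < x" and m: "m \<ge> 1" and w: "\<bar>w\<bar> < x ^ m"
    and \<zeta>: "\<And>s. Re s > 1 \<Longrightarrow> \<zeta> s = hurwitz_sum x s"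
  defines "u \<equiv> \<lambda>k. of_real (w / (real k + x) ^ m) :: complex"
  shows "summable (\<lambda>k. - ln (1 - u k) - u k)"
    and "(\<Sum>j. tail_term \<zeta> m w j 0) = (\<Sum>k. - ln (1 - u k) - u k)"
proof -
  define f where "f j k = u k ^ (j + 2) / of_nat (j + 2)" for j k
  define q where "q = \<bar>w\<bar> / x ^ m"
  have q: "0 \<le> q" "q < 1" using w x by (auto simp: q_def)
  have u: "norm (u k) \<le> q" for k
  proof -
    have "x ^ m \<le> (real k + x) ^ m" using x by (intro power_mono) auto
    thus ?thesis using x by (auto simp: u_def q_def norm_divide norm_power intro!: divide_left_mono mult_pos_pos simp del: of_real_divide)
  qed
  define B where "B k = w ^ 2 * (real k + x) powr (- (2 * real m))" for k
  have u2: "norm (u k) ^ 2 = B k" for k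
  proof -
    have "(real k + x) powr (- (2 * real m)) = 1 / ((real k + x) ^ m) ^ 2"
      using x powr_realpow[of "real k + x" "m * 2"]
      by (simp add: powr_minus power_mult field_simps)
    thus ?thesis using x by (simp add: u_def B_def norm_divide norm_power power_divide del: of_real_divide)
  qed
  have bound: "norm (f j k) \<le> q ^ j * B k" for j k
  proof -
    have "norm (f j k) = norm (u k) ^ j * norm (u k) ^ 2 / real (j + 2)"
      unfolding f_def norm_divide norm_of_nat power_add norm_mult norm_power ..
    also have "\<dots> \<le> norm (u k) ^ j * norm (u k) ^ 2 / 1"
      by (intro divide_left_mono) auto
    also have "\<dots> \<le> q ^ j * B k"
      unfolding u2 using u q by (auto intro!: mult_right_mono power_mono simp: B_def)
    finally show ?thesis .
  qed
  have sA: "summable (\<lambda>j. q ^ j)" using q by (intro summable_geometric) auto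
  have sB: "summable B" unfolding B_def using x m by (intro summable_mult summable_shift_powr) auto
  have nn: "0 \<le> q ^ j" "0 \<le> B k" for j k using q by (auto simp: B_def)
  have col: "(\<Sum>j. f j k) = - ln (1 - u k) - u k" for k
  proof -
    have "norm (- u k) < 1" using u[of k] q by simp
    from Ln_series'[OF this] have "(\<lambda>n. - (u k ^ n / of_nat n)) sums ln (1 - u k)" by simp
    from sums_split_initial_segment[OF sums_minus[OF this], of 2]
    have "(\<lambda>j. f j k) sums (- ln (1 - u k) - (\<Sum>n<2. u k ^ n / of_nat n))"
      by (simp add: f_def)
    thus ?thesis by (simp add: sums_iff numeral_2_eq_2)
  qed
  show "summable (\<lambda>k. - ln (1 - u k) - u k)"
    using summable_suminf_dominated[OF bound sA sB nn] unfolding col .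
  have row: "(\<Sum>k. f j k) = tail_term \<zeta> m w j 0" for j
  proof -
    have "1 * 2 \<le> real m * real (j + 2)" using m by (intro mult_mono) auto
    hence Re: "1 < Re (of_nat m * (0 + of_nat (j + 2)))" by simp
    have "(\<lambda>k. of_real (real k + x) powr (- (of_nat m * (0 + of_nat (j + 2))))) sums
        hurwitz_sum x (of_nat m * (0 + of_nat (j + 2)))"
      unfolding hurwitz_sum_def
      by (intro summable_sums summable_norm_cancel[OF summable_hurwitz_sum[OF x Re]])
    from sums_mult[OF this, of "of_real w ^ (j + 2) / of_nat (j + 2)"]
    have "(\<lambda>k. of_real w ^ (j + 2) / of_nat (j + 2) *
            of_real (real k + x) powr (- (of_nat m * (0 + of_nat (j + 2))))) sums
          (of_real w ^ (j + 2) / of_nat (j + 2) * \<zeta> (of_nat m * (0 + of_nat (j + 2))))"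
      unfolding \<zeta>[OF Re] .
    moreover have "of_real w ^ (j + 2) / of_nat (j + 2) *
            of_real (real k + x) powr (- (of_nat m * (0 + of_nat (j + 2)))) = f j k" for k
    proof -
      have "of_real (real k + x) \<noteq> (0 :: complex)" using x unfolding of_real_eq_0_iff by linarith
      hence "of_real (real k + x) powr (- (of_nat m * (0 + of_nat (j + 2)))) =
              (1 / (of_real ((real k + x) ^ m)) ^ (j + 2) :: complex)"
        using powr_nat'[of "of_real (real k + x) :: complex" "m * (j + 2)"]
        by (simp only: powr_minus of_nat_mult[symmetric] add_0_left power_mult of_real_power inverse_eq_divide) simp
      thus ?thesis by (simp add: f_def u_def power_divide del: of_real_add)
    qed
    moreover have "of_real w ^ (j + 2) / of_nat (j + 2) * \<zeta> (of_nat m * (0 + of_nat (j + 2))) =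
        tail_term \<zeta> m w j 0"
    proof -
      have "((- 0 - 1) gchoose (j + 1)) = (-1 :: complex) ^ (j + 1)"
        using gbinomial_minus[of "1::complex" "j + 1"] binomial_gbinomial[of "j + 1" "j + 1", where ?'a = complex]
        by simp
      moreover have "of_real (- w) ^ (j + 2) = (-1) ^ (j + 2) * (of_real w ^ (j + 2) :: complex)"
        by (simp only: of_real_minus power_minus[of "of_real w"])
      ultimately show ?thesis unfolding tail_term_def by (simp add: power_mult_distrib[symmetric])
    qed
    ultimately show ?thesis by (simp add: sums_iff)
  qed
  show "(\<Sum>j. tail_term \<zeta> m w j 0) = (\<Sum>k. - ln (1 - u k) - u k)"
    using suminf_swap_dominated[OF bound sA sB nn] unfolding col row .
qed

text \<open>The two constants are \<open>\<alpha> = \<zeta>'(0)\<close> and the derivative \<open>\<beta>\<close> at \<open>1\<close> of \<open>(s - 1) \<zeta>(s)\<close>.  They depend on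
\<open>x\<close> alone: for \<open>m = 1\<close> and varying \<open>w\<close> they form an affine function of \<open>w\<close>, and the case \<open>m = 1\<close>,
\<open>w = 0\<close> expresses the \<open>\<alpha>\<close> that occurs for \<open>m \<ge> 2\<close>.\<close>

lemma has_zeta_regprod_shifted_powers:
  assumes x: "0 < x"
  obtains \<alpha> \<beta> :: complex where
    "\<And>m w. m \<ge> 1 \<Longrightarrow> \<bar>w\<bar> < x ^ m \<Longrightarrow>
      (\<lambda>k. (real k + x) ^ m - w) has_zeta_regprod
      exp (- (of_nat m * \<alpha> + of_real w * (if m = 1 then \<beta> else hurwitz_sum x (of_nat m)) +
              (\<Sum>k. - ln (1 - of_real (w / (real k + x) ^ m)) - of_real (w / (real k + x) ^ m))))"
proof -
  obtain G where G: "G holomorphic_on UNIV" and Gs: "\<And>s. Re s > 1 \<Longrightarrow> G s = (s - 1) * hurwitz_sum x s"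
    using hurwitz_continuation[OF x] by blast
  define \<zeta> where "\<zeta> s = G s / (s - 1)" for s
  have \<zeta>: "\<zeta> s = hurwitz_sum x s" if "Re s > 1" for s
  proof -
    have "s \<noteq> 1" using that by auto
    thus ?thesis by (simp add: \<zeta>_def Gs[OF that])
  qed
  have hol: "\<zeta> holomorphic_on UNIV - {1}"
    unfolding \<zeta>_def by (intro holomorphic_intros holomorphic_on_subset[OF G]) auto
  have Gan: "G analytic_on A" for A
    using G by (metis analytic_on_holomorphic analytic_on_subset open_UNIV subset_UNIV)
  have mero: "\<zeta> meromorphic_on UNIV"
    unfolding \<zeta>_def by (intro meromorphic_intros analytic_on_imp_meromorphic_on Gan)
  have Gd: "(G has_field_derivative deriv G z) (at z)" for z
    using G by (intro holomorphic_derivI[of _ UNIV]) auto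
  define \<alpha> where "\<alpha> = deriv \<zeta> 0"
  define \<beta> where "\<beta> = deriv G 1"
  have \<zeta>d: "(\<zeta> has_field_derivative deriv \<zeta> z) (at z)" if "z \<noteq> 1" for z
    using hol that by (intro holomorphic_derivI[of _ "UNIV - {1}"]) (auto intro: open_delete)
  have "(\<lambda>k. (real k + x) ^ m - w) has_zeta_regprod
      exp (- (of_nat m * \<alpha> + of_real w * (if m = 1 then \<beta> else hurwitz_sum x (of_nat m)) +
              (\<Sum>k. - ln (1 - of_real (w / (real k + x) ^ m)) - of_real (w / (real k + x) ^ m))))"
    if m: "m \<ge> 1" and w: "\<bar>w\<bar> < x ^ m" for m w
  proof -
    define U where "U s = (\<Sum>j. tail_term \<zeta> m w j s)" for s
    \<comment> \<open>For m = 1 the factor s cancels the pole of the zeta function at 1; using G here gives Z the right value at 0.\<close>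
    define E where "E s = (if m = 1 then of_real w * G (s + 1)
                           else s * of_real w * \<zeta> (of_nat m * s + of_nat m))" for s
    define Z where "Z s = \<zeta> (of_nat m * s) + E s + s * U s" for s
    have U_mero: "U meromorphic_on UNIV"
      unfolding U_def by (rule meromorphic_tail[OF x m w \<zeta> hol mero])
    have U_hol: "U holomorphic_on {s. Re s > -1}"
      unfolding U_def
    proof (rule holomorphic_tail[OF x m w \<zeta>])
      fix j
      have "of_nat m * (s + of_nat (j + 2)) \<in> UNIV - {1}" if s: "Re s > -1" for s :: complex
      proof -
        have "1 * (Re s + real (j + 2)) \<le> real m * (Re s + real (j + 2))"
          using m s by (intro mult_right_mono) auto
        moreover have "1 < 1 * (Re s + real (j + 2))" using s by simp
        ultimately have "1 < real m * (Re s + real (j + 2))" by linarith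
        hence "Re (of_nat m * (s + of_nat (j + 2))) > 1" by simp
        moreover have "z \<in> UNIV - {1}" if "Re z > 1" for z :: complex using that by auto
        ultimately show ?thesis by blast
      qed
      hence 1: "(\<zeta> \<circ> (\<lambda>s. of_nat m * (s + of_nat (j + 2)))) holomorphic_on {s. Re s > -1}"
        by (intro holomorphic_on_compose_gen[OF _ hol] holomorphic_intros) auto
      have 2: "(\<lambda>s. (- s - 1) gchoose (j + 1)) holomorphic_on {s. Re s > -1}"
        by (intro analytic_imp_holomorphic analytic_intros)
      show "tail_term \<zeta> m w j holomorphic_on {s. Re s > -1}"
        unfolding tail_term_def by (intro holomorphic_intros 1[unfolded o_def] 2)
    qed (auto simp: open_halfspace_Re_gt)
    have E_mero: "E meromorphic_on UNIV"
    proof (cases "m = 1")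
      case True
      have "(\<lambda>s. s + 1) holomorphic_on (UNIV :: complex set)" by (intro holomorphic_intros)
      from holomorphic_on_compose_gen[OF this G]
      have "(\<lambda>s. of_real w * G (s + 1)) holomorphic_on UNIV"
        by (intro holomorphic_intros) (simp add: o_def)
      thus ?thesis
        unfolding E_def using True by (auto intro!: analytic_on_imp_meromorphic_on simp: analytic_on_open)
    next
      case False
      have "(\<lambda>s. \<zeta> (of_nat m * s + of_nat m)) meromorphic_on UNIV"
        by (rule meromorphic_on_compose[OF mero]) (auto intro!: analytic_intros)
      thus ?thesis unfolding E_def using False by (auto intro!: meromorphic_intros)
    qed
    have "(\<lambda>s. \<zeta> (of_nat m * s)) meromorphic_on UNIV"
      by (rule meromorphic_on_compose[OF mero]) (auto intro!: analytic_intros)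
    hence Z_mero: "Z meromorphic_on UNIV"
      unfolding Z_def by (intro meromorphic_intros E_mero U_mero)
    define D where "D = (if m = 1 then \<beta> else hurwitz_sum x (of_nat m))"
    have E0: "(E has_field_derivative of_real w * D) (at 0)"
    proof (cases "m = 1")
      case True
      have "((\<lambda>s. of_real w * G (s + 1)) has_field_derivative of_real w * \<beta>) (at 0)"
        using DERIV_cmult[OF Gd[of "0 + 1", unfolded DERIV_shift]] by (simp add: \<beta>_def)
      thus ?thesis using True by (simp add: E_def[abs_def] D_def)
    next
      case False
      have m1: "of_nat m \<noteq> (1::complex)" using False by (metis of_nat_1 of_nat_eq_iff)
      have "((\<lambda>s. s * of_real w * \<zeta> (of_nat m * s + of_nat m)) has_field_derivative of_real w * \<zeta> (of_nat m)) (at 0)"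
        by (rule derivative_eq_intros DERIV_chain2[OF \<zeta>d] refl | use m1 in simp)+
      thus ?thesis using False m by (simp add: E_def[abs_def] D_def \<zeta>)
    qed
    have U0: "(U has_field_derivative deriv U 0) (at 0)"
      using U_hol by (intro holomorphic_derivI[of _ "{s. Re s > -1}"]) (auto simp: open_halfspace_Re_gt)
    have "(Z has_field_derivative (of_nat m * \<alpha> + of_real w * D + U 0)) (at 0)"
      unfolding Z_def[abs_def] \<alpha>_def
      by (rule derivative_eq_intros DERIV_chain2[OF \<zeta>d] refl E0 U0 | simp)+
    hence Z0: "deriv Z 0 = of_nat m * \<alpha> + of_real w * D + U 0" and "isCont Z 0"
      by (auto intro: DERIV_imp_deriv DERIV_isCont)
    hence "Z analytic_on {0}"
      by (intro meromorphic_at_isCont_imp_analytic meromorphic_on_subset[OF Z_mero]) auto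
    moreover have "summable (\<lambda>k. norm (complex_of_real ((real k + x) ^ m - w) powr (- s))) \<and>
                   Z s = (\<Sum>k. complex_of_real ((real k + x) ^ m - w) powr (- s))" if s: "Re s > 1" for s
    proof -
      have "E s = s * of_real w * \<zeta> (of_nat m * s + of_nat m)"
      proof (cases "m = 1")
        case True
        have "s \<noteq> 0" using s by auto
        with True show ?thesis by (simp add: E_def \<zeta>_def)
      qed (simp add: E_def)
      thus ?thesis
        using sum_shifted_powers_eq[OF x m w \<zeta> s] by (simp add: Z_def U_def)
    qed
    ultimately have "zeta_continuation (\<lambda>k. (real k + x) ^ m - w) Z"
      unfolding zeta_continuation_def using Z_mero by blast
    moreover have "0 < (real k + x) ^ m - w" for k
    proof -
      have "x ^ m \<le> (real k + x) ^ m" using x by (intro power_mono) auto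
      thus ?thesis using w by simp
    qed
    moreover have "incseq (\<lambda>k. (real k + x) ^ m - w)"
      using x by (intro incseq_SucI diff_mono power_mono) auto
    moreover have "U 0 = (\<Sum>k. - ln (1 - of_real (w / (real k + x) ^ m)) - of_real (w / (real k + x) ^ m))"
      unfolding U_def by (rule suminf_tail_term_0[OF x m w \<zeta>])
    ultimately show ?thesis
      unfolding has_zeta_regprod_def D_def[symmetric] using Z0 by metis
  qed
  thus thesis by (rule that)
qed

section \<open>Uniqueness of continuations\<close>

text \<open>The difference of two continuations is meromorphic and vanishes on a half-plane, hence off a discrete
set.  Analyticity at \<open>0\<close> then makes it vanish in a full neighbourhood of \<open>0\<close>.\<close>

lemma zeta_continuation_deriv_unique:
  assumes "zeta_continuation b Z1" "zeta_continuation b Z2"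
  shows "deriv Z1 0 = deriv Z2 0"
proof -
  define D where "D z = Z1 z - Z2 z" for z
  have an: "Z1 analytic_on {0}" "Z2 analytic_on {0}"
    and mero: "D meromorphic_on UNIV"
    using assms unfolding zeta_continuation_def D_def by (auto intro!: meromorphic_intros)
  obtain \<sigma>1 \<sigma>2 where "\<forall>s. Re s > \<sigma>1 \<longrightarrow> Z1 s = (\<Sum>k. complex_of_real (b k) powr (- s))"
      "\<forall>s. Re s > \<sigma>2 \<longrightarrow> Z2 s = (\<Sum>k. complex_of_real (b k) powr (- s))"
    using assms unfolding zeta_continuation_def by metis
  hence D0: "D s = 0" if "Re s > max \<sigma>1 \<sigma>2" for s using that by (simp add: D_def)
  define p where "p = complex_of_real (max \<sigma>1 \<sigma>2 + 1)"
  have "\<forall>\<^sub>F s in at p. D s = 0"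
    by (rule eventually_mono[OF eventually_at_in_open'[OF open_halfspace_Re_gt[of "max \<sigma>1 \<sigma>2"]]])
       (use D0 in \<open>auto simp: p_def\<close>)
  hence "\<not> (\<forall>\<^sub>F s in at p. D s \<noteq> 0)"
    using eventually_conj[of "\<lambda>s. D s = 0" "at p" "\<lambda>s. D s \<noteq> 0"] by (auto simp: eventually_False)
  hence "\<not> (\<forall>\<^sub>F s in cosparse UNIV. D s \<noteq> 0)"
    by (auto simp: eventually_cosparse_open_eq)
  with meromorphic_imp_constant_or_avoid[OF mero, of 0]
  have "\<forall>\<^sub>F s in cosparse UNIV. D s = 0" by auto
  hence ev: "\<forall>\<^sub>F s in at 0. D s = 0" by (simp add: eventually_cosparse_open_eq)
  have "isCont D 0"
    unfolding D_def using an by (intro continuous_intros analytic_at_imp_isCont)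
  hence "(D \<longlongrightarrow> D 0) (at 0)" by (simp add: isCont_def)
  moreover have "(D \<longlongrightarrow> 0) (at 0)" by (rule tendsto_eventually[OF ev])
  ultimately have "D 0 = 0" using tendsto_unique[of "at (0::complex)"] by simp
  with ev have "\<forall>\<^sub>F s in nhds 0. D s = 0"
    by (auto simp: eventually_at_filter elim: eventually_mono)
  hence "\<forall>\<^sub>F s in nhds 0. Z1 s = Z2 s" by (simp add: D_def)
  thus ?thesis by (intro deriv_cong_ev) auto
qed

lemma has_zeta_regprod_unique:
  "b has_zeta_regprod P \<Longrightarrow> b has_zeta_regprod Q \<Longrightarrow> P = Q"
  unfolding has_zeta_regprod_def using zeta_continuation_deriv_unique by metis

lemma entire_eqI_real_ray:
  assumes "F holomorphic_on UNIV" "G holomorphic_on UNIV"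
    and eq: "\<And>x::real. a < x \<Longrightarrow> F (of_real x) = G (of_real x)"
  shows "F z = (G z :: complex)"
proof -
  have "F z - G z = 0"
  proof (rule analytic_continuation[of "\<lambda>z. F z - G z" UNIV "of_real ` {a<..}" "of_real (a + 1)"])
    show "complex_of_real (a + 1) islimpt of_real ` {a<..}"
      unfolding islimpt_approachable
    proof safe
      fix e :: real assume "0 < e"
      thus "\<exists>x'\<in>complex_of_real ` {a<..}. x' \<noteq> of_real (a + 1) \<and> dist x' (of_real (a + 1)) < e"
        by (intro bexI[of _ "of_real (a + 1 + e / 2)"] imageI) (auto simp: dist_norm norm_mult)
    qed
  qed (use assms in \<open>auto intro!: holomorphic_intros\<close>)
  thus ?thesis by simp
qed

section \<open>The regularized product of an arithmetic progression\<close>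

lemma LIMSEQ_prod_exp_suminf_log:
  fixes u :: "nat \<Rightarrow> complex"
  assumes u: "\<And>k. u k \<noteq> 1" and sum: "summable (\<lambda>k. - ln (1 - u k) - u k)"
  shows "(\<lambda>n. \<Prod>k<n. (1 - u k) * exp (u k)) \<longlonglongrightarrow> exp (- (\<Sum>k. - ln (1 - u k) - u k))"
proof -
  have "(\<lambda>n. exp (- (\<Sum>k<n. - ln (1 - u k) - u k))) \<longlonglongrightarrow> exp (- (\<Sum>k. - ln (1 - u k) - u k))"
    using summable_LIMSEQ[OF sum] by (intro tendsto_intros)
  moreover have "exp (- (\<Sum>k<n. - ln (1 - u k) - u k)) = (\<Prod>k<n. (1 - u k) * exp (u k))" for n
  proof -
    have "- (\<Sum>k<n. - ln (1 - u k) - u k) = (\<Sum>k<n. ln (1 - u k) + u k)"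
      by (simp add: sum_negf[symmetric] add.commute)
    thus ?thesis using u by (simp add: exp_sum exp_add)
  qed
  ultimately show ?thesis by simp
qed

lemma rGamma_of_real_neq_0:
  assumes "0 < (t::real)"
  shows "rGamma (complex_of_real t) \<noteq> 0"
proof
  assume "rGamma (complex_of_real t) = 0"
  then obtain n :: nat where "complex_of_real t = - of_nat n"
    by (auto simp: rGamma_eq_zero_iff elim!: nonpos_Ints_cases')
  hence "Re (complex_of_real t) = Re (- of_nat n)" by (rule arg_cong)
  thus False using assms by simp
qed

lemma rGamma_series_eq:
  "rGamma_series z n = (\<Prod>k<Suc n. z + of_nat k) / (fact n * exp (z * of_real (ln (of_nat n))))"
  unfolding rGamma_series_def by (simp add: pochhammer_prod atLeast0LessThan)

text \<open>Weierstrass' product for the Gamma function, recentred at \<open>x\<close>: Euler's limit for \<open>1 / \<Gamma>(x - w)\<close> is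
Euler's limit for \<open>1 / \<Gamma>(x)\<close> times a product over \<open>1 - w / (k + x)\<close>, and the factors \<open>exp (u k)\<close> that
make this product converge are compensated by \<open>exp (w \<delta>)\<close>.\<close>

lemma rGamma_shift_conv_product:
  fixes x w :: real
  assumes x: "0 < x" and w: "\<bar>w\<bar> < x"
  defines "u \<equiv> \<lambda>k. of_real (w / (real k + x)) :: complex"
  assumes sum: "summable (\<lambda>k. - ln (1 - u k) - u k)"
    and \<delta>: "(\<lambda>n. of_real (ln (real n)) - (\<Sum>k<Suc n. inverse (of_real x + of_nat k))) \<longlonglongrightarrow> (\<delta> :: complex)"
  shows "rGamma (of_real (x - w)) = rGamma (of_real x) * exp (- (\<Sum>k. - ln (1 - u k) - u k)) * exp (of_real w * \<delta>)"
proof -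
  have nz: "of_real x + of_nat k \<noteq> (0 :: complex)" for k
  proof -
    have "real k + x \<noteq> 0" using x by linarith
    thus ?thesis by (metis add.commute of_real_add of_real_eq_0_iff of_real_of_nat_eq)
  qed
  have u: "u k = of_real w / (of_real x + of_nat k)" for k by (simp add: u_def add.commute)
  have u1: "u k \<noteq> 1" for k
  proof
    assume "u k = 1"
    hence "w / (real k + x) = 1" unfolding u_def by (simp only: of_real_eq_1_iff)
    thus False using x w by (simp add: divide_eq_1_iff)
  qed
  have "rGamma_series (of_real (x - w)) n = rGamma_series (of_real x) n *
          (\<Prod>k<Suc n. (1 - u k) * exp (u k)) *
          exp (of_real w * (of_real (ln (real n)) - (\<Sum>k<Suc n. inverse (of_real x + of_nat k))))" for n
  proof -
    have "(\<Prod>k<Suc n. of_real (x - w) + of_nat k) = (\<Prod>k<Suc n. (of_real x + of_nat k) * (1 - u k) :: complex)"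
      using nz by (intro prod.cong refl) (simp add: u field_simps)
    hence 1: "(\<Prod>k<Suc n. of_real (x - w) + of_nat k) =
        (\<Prod>k<Suc n. of_real x + of_nat k) * (\<Prod>k<Suc n. 1 - u k)"
      by (simp only: prod.distrib)
    have "(\<Sum>k<Suc n. u k) = of_real w * (\<Sum>k<Suc n. inverse (of_real x + of_nat k))"
      unfolding sum_distrib_left u by (simp only: divide_inverse)
    hence 2: "(\<Prod>k<Suc n. exp (u k)) = exp (of_real w * (\<Sum>k<Suc n. inverse (of_real x + of_nat k)))"
      by (simp only: exp_sum[symmetric] finite_lessThan)
    have 3: "exp (of_real (x - w) * of_real (ln (real n))) =
        exp (of_real x * of_real (ln (real n))) / exp (of_real w * of_real (ln (real n)) :: complex)"
      by (simp add: left_diff_distrib exp_diff)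
    show ?thesis
      unfolding rGamma_series_eq 1 3 prod.distrib 2 right_diff_distrib exp_diff
      by (simp add: field_simps del: prod.lessThan_Suc sum.lessThan_Suc)
  qed
  hence "(\<lambda>n. rGamma_series (of_real (x - w)) n) = (\<lambda>n. rGamma_series (of_real x) n *
          (\<Prod>k<Suc n. (1 - u k) * exp (u k)) *
          exp (of_real w * (of_real (ln (real n)) - (\<Sum>k<Suc n. inverse (of_real x + of_nat k)))))" ..
  moreover have "(\<lambda>n. rGamma_series (of_real x) n *
          (\<Prod>k<Suc n. (1 - u k) * exp (u k)) *
          exp (of_real w * (of_real (ln (real n)) - (\<Sum>k<Suc n. inverse (of_real x + of_nat k)))))
       \<longlonglongrightarrow> rGamma (of_real x) * exp (- (\<Sum>k. - ln (1 - u k) - u k)) * exp (of_real w * \<delta>)"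
    using LIMSEQ_prod_exp_suminf_log[OF u1 sum]
    by (intro tendsto_intros \<delta> filterlim_compose[OF _ filterlim_Suc])
  ultimately show ?thesis
    using rGamma_series_LIMSEQ[of "of_real (x - w) :: complex"] LIMSEQ_unique by metis
qed

text \<open>The progression \<open>k + t\<close> is \<open>(k + x) - w\<close> with \<open>w = x - t\<close>, and \<open>\<bar>w\<bar> < x\<close> means \<open>0 < t < 2 x\<close>.  The
regularized product at \<open>t\<close> and the recentred product for \<open>1 / \<Gamma>(t)\<close> contain the same logarithmic
series, so their quotient is the exponential of an affine function of \<open>t\<close>.\<close>

lemma has_zeta_regprod_arith_local:
  assumes x: "0 < x"
  obtains A B :: complex where
    "\<And>t. 0 < t \<Longrightarrow> t < 2 * x \<Longrightarrow>
       (\<lambda>k. real k + t) has_zeta_regprod exp (A + B * of_real t) * rGamma (of_real t)"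
proof -
  obtain \<alpha> \<beta> where reg: "\<And>m w. m \<ge> 1 \<Longrightarrow> \<bar>w\<bar> < x ^ m \<Longrightarrow>
      (\<lambda>k. (real k + x) ^ m - w) has_zeta_regprod
      exp (- (of_nat m * \<alpha> + of_real w * (if m = 1 then \<beta> else hurwitz_sum x (of_nat m)) +
              (\<Sum>k. - ln (1 - of_real (w / (real k + x) ^ m)) - of_real (w / (real k + x) ^ m))))"
    using has_zeta_regprod_shifted_powers[OF x] by blast
  have x0: "of_real x \<noteq> (0 :: complex)" using x by simp
  define \<delta> where "\<delta> = Digamma (of_real x :: complex)"
  have "(\<lambda>n. (of_real (ln (real n)) - (\<Sum>k<n. inverse (of_real x + of_nat k))) - inverse (of_real x + of_nat n))
          \<longlonglongrightarrow> \<delta> - 0"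
    unfolding \<delta>_def
  proof (intro tendsto_diff Digamma_LIMSEQ x0)
    show "(\<lambda>n. inverse (of_real x + of_nat n :: complex)) \<longlonglongrightarrow> 0"
      by (intro tendsto_inverse_0 [THEN filterlim_compose] tendsto_add_filterlim_at_infinity[OF tendsto_const]
           tendsto_of_nat)
  qed
  hence \<delta>: "(\<lambda>n. of_real (ln (real n)) - (\<Sum>k<Suc n. inverse (of_real x + of_nat k))) \<longlonglongrightarrow> \<delta>"
    by (simp add: algebra_simps)
  have rG: "rGamma (of_real x :: complex) \<noteq> 0"
    using x by (rule rGamma_of_real_neq_0)
  define c where "c = ln (rGamma (of_real x :: complex))"
  have c: "rGamma (of_real x) = exp c" unfolding c_def using rG by simp
  have "(\<lambda>k. real k + t) has_zeta_regprod
          exp ((- \<alpha> - of_real x * (\<beta> + \<delta>) - c) + (\<beta> + \<delta>) * of_real t) * rGamma (of_real t)"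
    if t: "0 < t" "t < 2 * x" for t
  proof -
    define w where "w = x - t"
    have w: "\<bar>w\<bar> < x" using t by (auto simp: w_def)
    let ?u = "\<lambda>k. of_real (w / (real k + x)) :: complex"
    let ?S = "\<Sum>k. - ln (1 - ?u k) - ?u k"
    have "summable (\<lambda>k. - ln (1 - ?u k) - ?u k)"
      using suminf_tail_term_0(1)[OF x, of 1 w "hurwitz_sum x"] w by simp
    from rGamma_shift_conv_product[OF x w this \<delta>]
    have rt: "rGamma (of_real t) = exp c * exp (- ?S) * exp (of_real w * \<delta>)"
      by (simp add: w_def c)
    have "exp ((- \<alpha> - of_real x * (\<beta> + \<delta>) - c) + (\<beta> + \<delta>) * of_real t) * rGamma (of_real t) =
        exp ((- \<alpha> - of_real x * (\<beta> + \<delta>) - c) + (\<beta> + \<delta>) * of_real t + c + - ?S + of_real w * \<delta>)"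
      by (simp only: rt exp_add mult.assoc)
    also have "(- \<alpha> - of_real x * (\<beta> + \<delta>) - c) + (\<beta> + \<delta>) * of_real t + c + - ?S + of_real w * \<delta> =
        - (of_nat 1 * \<alpha> + of_real w * \<beta> + ?S)"
      by (simp add: w_def algebra_simps)
    finally show ?thesis
      using reg[of 1 w] w by (simp add: w_def add_diff_eq)
  qed
  thus thesis by (rule that)
qed

text \<open>The affine functions found on the intervals \<open>(0, 2 x)\<close> have the same exponential on \<open>(0, 2)\<close>, hence
everywhere.  This is Lerch's formula up to the values of \<open>A\<close> and \<open>B\<close>.\<close>

lemma has_zeta_regprod_arith:
  obtains A B :: complex where
    "\<And>t. 0 < t \<Longrightarrow> (\<lambda>k. real k + t) has_zeta_regprod exp (A + B * of_real t) * rGamma (of_real t)"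
proof -
  obtain A B where AB: "\<And>t. 0 < t \<Longrightarrow> t < 2 \<Longrightarrow>
       (\<lambda>k. real k + t) has_zeta_regprod exp (A + B * of_real t) * rGamma (of_real t)"
    using has_zeta_regprod_arith_local[of 1] by auto
  have "(\<lambda>k. real k + t) has_zeta_regprod exp (A + B * of_real t) * rGamma (of_real t)"
    if t: "0 < t" for t
  proof -
    obtain A' B' where AB': "\<And>r. 0 < r \<Longrightarrow> r < 2 * (t + 1) \<Longrightarrow>
         (\<lambda>k. real k + r) has_zeta_regprod exp (A' + B' * of_real r) * rGamma (of_real r)"
      using has_zeta_regprod_arith_local[of "t + 1"] t by auto
    have eq: "exp (A' + B' * of_real r) = exp (A + B * of_real r)" if r: "0 < r" "r < 2" for r
      using has_zeta_regprod_unique[OF AB[OF r] AB'[of r]] r t rGamma_of_real_neq_0[of r] by simp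
    have "exp (A' + B' * of_real t) - exp (A + B * of_real t) = 0"
    proof (rule analytic_continuation[of "\<lambda>z. exp (A' + B' * z) - exp (A + B * z)" UNIV "of_real ` {0<..<2}" 1])
      show "(1::complex) islimpt of_real ` {0<..<2}"
        unfolding islimpt_approachable
      proof safe
        fix e :: real assume "0 < e"
        define d where "d = min e 1 / 2"
        have d: "0 < d" "d < 1" "d < e" using \<open>0 < e\<close> by (auto simp: d_def)
        show "\<exists>x'\<in>complex_of_real ` {0<..<2}. x' \<noteq> 1 \<and> dist x' 1 < e"
          using d by (intro bexI[of _ "of_real (1 + d)"] imageI) (auto simp: dist_norm)
      qed
    qed (use eq in \<open>auto intro!: holomorphic_intros\<close>)
    thus ?thesis using AB'[of t] t by simp
  qed
  thus thesis by (rule that)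
qed

section \<open>Products over roots of unity\<close>

lemma prod_roots_unity_diff:
  fixes a b :: complex
  assumes m: "m \<ge> 1"
  shows "(\<Prod>\<xi> | \<xi> ^ m = 1. a - \<xi> * b) = a ^ m - b ^ m"
proof (cases "b = 0")
  case True
  thus ?thesis using m card_complex_roots_unity[OF m] by (simp add: power_0_left)
next
  case False
  let ?U = "{\<xi>::complex. \<xi> ^ m = 1}"
  have fin: "finite ?U" using m by (intro finite_roots_unity)
  have card: "card ?U = m" by (rule card_complex_roots_unity[OF m])
  let ?p = "\<Prod>\<xi>\<in>?U. [:- \<xi>, 1:]" and ?q = "Polynomial.monom 1 m - 1 :: complex poly"
  have degp: "degree ?p = m" by (simp add: degree_prod_sum_eq card)
  have "lead_coeff ?p = 1" by (simp add: lead_coeff_prod)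
  hence "poly.coeff ?p m = 1" by (simp add: degp)
  moreover have "poly.coeff ?q m = 1" using m by (simp add: coeff_1)
  moreover have "degree ?q \<le> m" by (intro degree_diff_le) (auto simp: degree_monom_le)
  moreover have "poly ?p z = poly ?q z" if "z \<in> ?U" for z
  proof -
    have "poly ?p z = 0" unfolding poly_prod using that fin by (intro prod_zero) auto
    thus ?thesis using that by (simp add: poly_monom)
  qed
  ultimately have "?p = ?q"
    using card degp by (intro poly_eqI_degree_lead_coeff[where A = ?U and n = m]) auto
  hence "poly ?p (a / b) = poly ?q (a / b)" by simp
  hence "(\<Prod>\<xi>\<in>?U. a / b - \<xi>) = (a / b) ^ m - 1" by (simp add: poly_prod poly_monom)
  moreover have "(\<Prod>\<xi>\<in>?U. a - \<xi> * b) = b ^ m * (\<Prod>\<xi>\<in>?U. a / b - \<xi>)"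
  proof -
    have "(\<Prod>\<xi>\<in>?U. a - \<xi> * b) = (\<Prod>\<xi>\<in>?U. b * (a / b - \<xi>))"
      using False by (intro prod.cong refl) (simp add: field_simps)
    thus ?thesis by (simp add: prod.distrib card)
  qed
  ultimately show ?thesis using False by (simp add: field_simps power_divide)
qed

text \<open>In Euler's limit the numerators multiply to \<open>\<Prod>k. (x + k)\<^sup>m - z\<^sup>m\<close>, while in the denominators the terms
linear in \<open>\<xi>\<close> cancel.\<close>

lemma prod_rGamma_roots_unity:
  fixes x z :: complex
  assumes m: "m \<ge> 2" and x: "\<And>k. x + of_nat k \<noteq> 0"
    and lim: "(\<lambda>n. \<Prod>k<n. 1 - z ^ m / (x + of_nat k) ^ m) \<longlonglongrightarrow> P"
  shows "(\<Prod>\<xi> | \<xi> ^ m = 1. rGamma (x - \<xi> * z)) = rGamma x ^ m * P"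
proof -
  let ?U = "{\<xi>::complex. \<xi> ^ m = 1}"
  have card: "card ?U = m" using m by (intro card_complex_roots_unity) auto
  have "(\<Prod>\<xi>\<in>?U. rGamma_series (x - \<xi> * z) n) =
          rGamma_series x n ^ m * (\<Prod>k<Suc n. 1 - z ^ m / (x + of_nat k) ^ m)" for n
  proof -
    let ?l = "of_real (ln (of_nat n)) :: complex"
    have "(\<Prod>\<xi>\<in>?U. \<Prod>k<Suc n. x - \<xi> * z + of_nat k) =
            (\<Prod>k<Suc n. \<Prod>\<xi>\<in>?U. (x + of_nat k) - \<xi> * z)"
      by (subst prod.swap, intro prod.cong refl) (simp add: algebra_simps)
    also have "\<dots> = (\<Prod>k<Suc n. (x + of_nat k) ^ m - z ^ m)"
      using m by (intro prod.cong refl prod_roots_unity_diff) auto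
    also have "\<dots> = (\<Prod>k<Suc n. (x + of_nat k) ^ m * (1 - z ^ m / (x + of_nat k) ^ m))"
      using x by (intro prod.cong refl) (simp add: right_diff_distrib)
    finally have num: "(\<Prod>\<xi>\<in>?U. \<Prod>k<Suc n. x - \<xi> * z + of_nat k) =
        (\<Prod>k<Suc n. x + of_nat k) ^ m * (\<Prod>k<Suc n. 1 - z ^ m / (x + of_nat k) ^ m)"
      by (simp only: prod.distrib prod_power_distrib)
    \<comment> \<open>This is where m = 1 is excluded: the sum of the roots of unity has to vanish.\<close>
    have "(\<Sum>\<xi>\<in>?U. (x - \<xi> * z) * ?l) = (of_nat m * x - (\<Sum>\<xi>\<in>?U. \<xi>) * z) * ?l"
      by (simp add: sum_distrib_right[symmetric] sum_subtractf card)
    also have "(\<Sum>\<xi>\<in>?U. \<xi>) = 0" using m by (intro sum_roots_unity) auto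
    finally have "(\<Prod>\<xi>\<in>?U. exp ((x - \<xi> * z) * ?l)) = exp (of_nat m * (x * ?l))"
      using m by (subst exp_sum[symmetric]) (auto intro: finite_roots_unity simp: mult.assoc)
    hence den: "(\<Prod>\<xi>\<in>?U. fact n * exp ((x - \<xi> * z) * ?l)) = (fact n * exp (x * ?l)) ^ m"
      by (simp add: prod.distrib card power_mult_distrib exp_of_nat_mult)
    show ?thesis
      unfolding rGamma_series_eq prod_dividef num den power_divide by simp
  qed
  moreover have "(\<lambda>n. rGamma_series x n ^ m * (\<Prod>k<Suc n. 1 - z ^ m / (x + of_nat k) ^ m)) \<longlonglongrightarrow> rGamma x ^ m * P"
    by (intro tendsto_intros filterlim_compose[OF lim filterlim_Suc])
  moreover have "(\<lambda>n. \<Prod>\<xi>\<in>?U. rGamma_series (x - \<xi> * z) n) \<longlonglongrightarrow> (\<Prod>\<xi>\<in>?U. rGamma (x - \<xi> * z))"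
    by (intro tendsto_intros)
  ultimately show ?thesis using LIMSEQ_unique by simp
qed

section \<open>The entire continuations\<close>

lemma is_L_continuation_unique:
  assumes F: "is_L_continuation F" and G: "is_L_continuation G"
  shows "F = G"
proof
  have "F (of_real x) = G (of_real x)" if "0 < x" for x :: real
    by (rule has_zeta_regprod_unique[of "\<lambda>k. real k + x"])
       (use F G that in \<open>simp_all add: is_L_continuation_def\<close>)
  thus "F z = G z" for z
    using F G entire_eqI_real_ray[of F G 0] by (simp add: is_L_continuation_def)
qed

lemma is_L_continuation_exp_rGamma:
  obtains A B where "is_L_continuation (\<lambda>z. exp (A + B * z) * rGamma z)"
proof -
  obtain A B where "\<And>t. 0 < t \<Longrightarrow>
      (\<lambda>k. real k + t) has_zeta_regprod exp (A + B * of_real t) * rGamma (of_real t)"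
    using has_zeta_regprod_arith by blast
  hence "is_L_continuation (\<lambda>z. exp (A + B * z) * rGamma z)"
    unfolding is_L_continuation_def by (auto intro!: holomorphic_intros)
  thus thesis by (rule that)
qed

lemma L_eq: "is_L_continuation F \<Longrightarrow> L = F"
  unfolding L_def by (rule the_equality) (auto intro: is_L_continuation_unique)

section \<open>Holomorphic functions of two variables\<close>

lemma entire2_linear_compose:
  assumes "F holomorphic_on UNIV"
  shows "entire2 (\<lambda>(u, v). F (u - c * v))"
  unfolding entire2_def
proof
  fix p :: "complex \<times> complex"
  define l where "l q = fst q - c * snd q" for q :: "complex \<times> complex"
  have "(F has_field_derivative deriv F (l p)) (at (l p))"
    using assms by (intro holomorphic_derivI[of _ UNIV]) auto
  hence "(F has_derivative (\<lambda>h. deriv F (l p) * h)) (at (l p))"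
    by (simp add: has_field_derivative_def)
  moreover have "(l has_derivative l) (at p)"
    unfolding l_def by (auto intro!: derivative_eq_intros)
  ultimately have "((\<lambda>q. F (l q)) has_derivative (\<lambda>h. deriv F (l p) * l h)) (at p)"
    by (rule has_derivative_compose[rotated])
  also have "(\<lambda>h. deriv F (l p) * l h) = (\<lambda>(u, v). deriv F (l p) * u + (- c * deriv F (l p)) * v)"
    by (auto simp: l_def algebra_simps)
  also have "(\<lambda>q. F (l q)) = (\<lambda>(u, v). F (u - c * v))" by (auto simp: l_def)
  finally show "\<exists>a b. ((\<lambda>(u, v). F (u - c * v)) has_derivative (\<lambda>(u, v). a * u + b * v)) (at p)"
    by blast
qed

lemma entire2_mult:
  assumes "entire2 F" "entire2 G"
  shows "entire2 (\<lambda>p. F p * G p)"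
  unfolding entire2_def
proof
  fix p
  obtain a b where F: "(F has_derivative (\<lambda>(u, v). a * u + b * v)) (at p)"
    using assms unfolding entire2_def by blast
  obtain c d where G: "(G has_derivative (\<lambda>(u, v). c * u + d * v)) (at p)"
    using assms unfolding entire2_def by blast
  have "((\<lambda>p. F p * G p) has_derivative
      (\<lambda>h. F p * (case h of (u, v) \<Rightarrow> c * u + d * v) + (case h of (u, v) \<Rightarrow> a * u + b * v) * G p)) (at p)"
    by (rule has_derivative_mult[OF F G])
  also have "(\<lambda>h. F p * (case h of (u, v) \<Rightarrow> c * u + d * v) + (case h of (u, v) \<Rightarrow> a * u + b * v) * G p) =
      (\<lambda>(u, v). (F p * c + a * G p) * u + (F p * d + b * G p) * v)"
    by (auto simp: algebra_simps)
  finally show "\<exists>a b. ((\<lambda>p. F p * G p) has_derivative (\<lambda>(u, v). a * u + b * v)) (at p)" by blast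
qed

lemma entire2_prod:
  assumes "finite I" "\<And>i. i \<in> I \<Longrightarrow> entire2 (F i)"
  shows "entire2 (\<lambda>p. \<Prod>i\<in>I. F i p)"
  using assms
proof (induction I)
  case empty
  show ?case
    unfolding entire2_def by (intro allI exI[of _ 0]) (simp add: case_prod_unfold)
qed (auto intro!: entire2_mult)

lemma entire2_holomorphic_slices:
  assumes "entire2 F"
  shows "(\<lambda>u. F (u, v)) holomorphic_on UNIV" "(\<lambda>v. F (u, v)) holomorphic_on UNIV"
proof -
  have "((\<lambda>u. F (u, v)) has_field_derivative a) (at u)" "((\<lambda>v. F (u, v)) has_field_derivative b) (at v)"
    if "(F has_derivative (\<lambda>(u, v). a * u + b * v)) (at (u, v))" for a b u v
  proof -
    have "((\<lambda>u. (u, v)) has_derivative (\<lambda>h. (h, 0))) (at u)" "((\<lambda>v. (u, v)) has_derivative (\<lambda>h. (0, h))) (at v)"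
      by (auto intro!: derivative_eq_intros)
    from this[THEN has_derivative_compose, OF that]
    show "((\<lambda>u. F (u, v)) has_field_derivative a) (at u)" "((\<lambda>v. F (u, v)) has_field_derivative b) (at v)"
      by (simp_all add: has_field_derivative_def)
  qed
  with assms show "(\<lambda>u. F (u, v)) holomorphic_on UNIV" "(\<lambda>v. F (u, v)) holomorphic_on UNIV"
    unfolding entire2_def holomorphic_on_open[OF open_UNIV] by blast+
qed

text \<open>The identity theorem is applied to one variable at a time: for fixed real \<open>y \<ge> 0\<close> along the ray
\<open>x > y\<close>, which gives equality for all complex \<open>x\<close>, and then for fixed \<open>x\<close> along \<open>y > 0\<close>.\<close>

lemma is_regprod_continuation_unique:
  assumes "is_regprod_continuation m \<epsilon> F" "is_regprod_continuation m \<epsilon> G"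
  shows "F = G"
proof -
  have ent: "entire2 F" "entire2 G"
    using assms by (simp_all add: is_regprod_continuation_def)
  have eq: "F (of_real x, of_real y) = G (of_real x, of_real y)" if "0 \<le> y" "y < x" for x y :: real
    by (rule has_zeta_regprod_unique[of "\<lambda>k. (real k + x) ^ m - \<epsilon> * y ^ m"])
       (use assms that in \<open>simp_all add: is_regprod_continuation_def\<close>)
  have 1: "F (u, of_real y) = G (u, of_real y)" if "0 \<le> y" for u and y :: real
    by (rule entire_eqI_real_ray[of "\<lambda>u. F (u, of_real y)" "\<lambda>u. G (u, of_real y)" y])
       (rule entire2_holomorphic_slices ent eq that | assumption)+
  have "F (u, v) = G (u, v)" for u v
    by (rule entire_eqI_real_ray[of "\<lambda>v. F (u, v)" "\<lambda>v. G (u, v)" 0])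
       (rule entire2_holomorphic_slices ent 1 less_imp_le | assumption)+
  thus ?thesis by auto
qed

section \<open>The product formula\<close>

text \<open>With \<open>w = \<epsilon> y\<^sup>m = (\<rho> y)\<^sup>m\<close>, the derivative at \<open>0\<close> contains the complete logarithmic series, as
\<open>w \<zeta>(m)\<close> supplies the linear term.  Hence the regularized product is \<open>exp (- \<alpha>)\<^sup>m\<close> times the ordinary
convergent product of \<open>1 - w / (k + x)\<^sup>m\<close>, and \<open>exp (- \<alpha>)\<close> is the regularized product of \<open>k + x\<close>.\<close>

lemma has_zeta_regprod_power_diff:
  fixes x y \<epsilon> :: real and \<rho> :: complex
  assumes m: "m \<ge> 2" and \<epsilon>: "\<epsilon> ^ 2 = 1" and \<rho>: "\<rho> ^ m = of_real \<epsilon>"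
    and L: "is_L_continuation (\<lambda>z. exp (A + B * z) * rGamma z)" and y: "0 \<le> y" "y < x"
  shows "(\<lambda>k. (real k + x) ^ m - \<epsilon> * y ^ m) has_zeta_regprod
           (\<Prod>\<xi> | \<xi> ^ m = 1. exp (A + B * (of_real x - \<xi> * \<rho> * of_real y)) *
                            rGamma (of_real x - \<xi> * \<rho> * of_real y))"
proof -
  let ?U = "{\<xi>::complex. \<xi> ^ m = 1}"
  have x: "0 < x" using y by simp
  have m1: "m \<ge> 1" "m \<noteq> 1" using m by auto
  have finU: "finite ?U" using m1 by (intro finite_roots_unity)
  have card: "card ?U = m" by (rule card_complex_roots_unity[OF m1(1)])
  obtain \<alpha> \<beta> where reg: "\<And>m w. m \<ge> 1 \<Longrightarrow> \<bar>w\<bar> < x ^ m \<Longrightarrow>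
      (\<lambda>k. (real k + x) ^ m - w) has_zeta_regprod
      exp (- (of_nat m * \<alpha> + of_real w * (if m = 1 then \<beta> else hurwitz_sum x (of_nat m)) +
              (\<Sum>k. - ln (1 - of_real (w / (real k + x) ^ m)) - of_real (w / (real k + x) ^ m))))"
    using has_zeta_regprod_shifted_powers[OF x] by blast
  define w where "w = \<epsilon> * y ^ m"
  have "\<bar>\<epsilon>\<bar> = 1" using \<epsilon> by (simp add: power2_eq_1_iff) auto
  hence w: "\<bar>w\<bar> < x ^ m"
    using y m by (simp add: w_def abs_mult power_strict_mono)
  define u where "u k = (of_real (w / (real k + x) ^ m) :: complex)" for k
  have u1: "u k \<noteq> 1" for k
  proof
    assume "u k = 1"
    hence "w / (real k + x) ^ m = 1" unfolding u_def by (simp only: of_real_eq_1_iff)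
    moreover have "x ^ m \<le> (real k + x) ^ m" using x by (intro power_mono) auto
    ultimately show False using w x by (auto simp: divide_eq_1_iff)
  qed
  have sum: "summable (\<lambda>k. - ln (1 - u k) - u k)"
    unfolding u_def by (rule suminf_tail_term_0(1)[OF x m1(1) w, of "hurwitz_sum x"]) simp
  let ?S = "\<Sum>k. - ln (1 - u k) - u k"
  have "(\<lambda>k. of_real w * of_real (real k + x) powr (- of_nat m)) sums (of_real w * hurwitz_sum x (of_nat m))"
    unfolding hurwitz_sum_def using m
    by (intro sums_mult summable_sums summable_norm_cancel[OF summable_hurwitz_sum[OF x]]) simp
  moreover have "of_real w * of_real (real k + x) powr (- of_nat m) = u k" for k
  proof -
    have "of_real (real k + x) \<noteq> (0 :: complex)" using x unfolding of_real_eq_0_iff by linarith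
    thus ?thesis by (simp add: u_def powr_minus powr_nat' divide_inverse del: of_real_add)
  qed
  ultimately have H: "u sums (of_real w * hurwitz_sum x (of_nat m))" by simp
  have "(\<lambda>n. (\<Prod>k<n. (1 - u k) * exp (u k)) * exp (- (\<Sum>k<n. u k))) \<longlonglongrightarrow>
          exp (- ?S) * exp (- (of_real w * hurwitz_sum x (of_nat m)))"
    using H unfolding sums_def by (intro tendsto_intros LIMSEQ_prod_exp_suminf_log[OF u1 sum])
  moreover have "(\<Prod>k<n. (1 - u k) * exp (u k)) * exp (- (\<Sum>k<n. u k)) = (\<Prod>k<n. 1 - u k)" for n
    by (simp add: prod.distrib exp_sum[symmetric] exp_minus)
  ultimately have lim: "(\<lambda>n. \<Prod>k<n. 1 - u k) \<longlonglongrightarrow>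
          exp (- ?S) * exp (- (of_real w * hurwitz_sum x (of_nat m)))" by simp
  have "(\<lambda>k. real k + x) has_zeta_regprod exp (- \<alpha>)"
    using reg[of 1 0] x by simp
  moreover have "(\<lambda>k. real k + x) has_zeta_regprod exp (A + B * of_real x) * rGamma (of_real x)"
    using L x unfolding is_L_continuation_def by simp
  ultimately have \<alpha>: "exp (- \<alpha>) = exp (A + B * of_real x) * rGamma (of_real x)"
    by (rule has_zeta_regprod_unique)
  have "(\<lambda>k. (real k + x) ^ m - w) has_zeta_regprod
      exp (- (of_nat m * \<alpha> + of_real w * hurwitz_sum x (of_nat m) + ?S))"
    using reg[OF m1(1) w] m1 by (simp add: u_def)
  also have "exp (- (of_nat m * \<alpha> + of_real w * hurwitz_sum x (of_nat m) + ?S)) =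
      exp (- \<alpha>) ^ m * (exp (- ?S) * exp (- (of_real w * hurwitz_sum x (of_nat m))))"
    by (simp add: exp_add[symmetric] exp_of_nat_mult[symmetric] algebra_simps)
  also have "exp (- \<alpha>) ^ m = exp (of_nat m * (A + B * of_real x)) * rGamma (of_real x) ^ m"
    unfolding \<alpha> by (simp add: power_mult_distrib exp_of_nat_mult)
  also have "\<dots> * (exp (- ?S) * exp (- (of_real w * hurwitz_sum x (of_nat m)))) =
      exp (of_nat m * (A + B * of_real x)) * (\<Prod>\<xi>\<in>?U. rGamma (of_real x - \<xi> * (\<rho> * of_real y)))"
  proof (subst prod_rGamma_roots_unity[OF m])
    show "of_real x + of_nat k \<noteq> (0 :: complex)" for k
    proof -
      have "real k + x \<noteq> 0" using x by linarith
      thus ?thesis by (metis add.commute of_real_add of_real_eq_0_iff of_real_of_nat_eq)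
    qed
    have "(\<rho> * of_real y) ^ m / (of_real x + of_nat k) ^ m = u k" for k
      by (simp add: u_def w_def power_mult_distrib \<rho> add.commute)
    thus "(\<lambda>n. \<Prod>k<n. 1 - (\<rho> * of_real y) ^ m / (of_real x + of_nat k) ^ m) \<longlonglongrightarrow>
        exp (- ?S) * exp (- (of_real w * hurwitz_sum x (of_nat m)))"
      using lim by simp
  qed simp
  also have "exp (of_nat m * (A + B * of_real x)) = (\<Prod>\<xi>\<in>?U. exp (A + B * (of_real x - \<xi> * (\<rho> * of_real y))))"
  proof -
    have "(\<Sum>\<xi>\<in>?U. A + B * (of_real x - \<xi> * (\<rho> * of_real y))) =
        of_nat m * (A + B * of_real x) - B * ((\<Sum>\<xi>\<in>?U. \<xi>) * (\<rho> * of_real y))"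
      by (simp add: sum.distrib sum_subtractf right_diff_distrib card
           sum_distrib_left[symmetric] sum_distrib_right[symmetric] algebra_simps)
    also have "(\<Sum>\<xi>\<in>?U. \<xi>) = 0" using m by (intro sum_roots_unity) auto
    finally show ?thesis using finU by (simp add: exp_sum[symmetric])
  qed
  finally show ?thesis by (simp add: w_def prod.distrib mult.assoc)
qed

theorem theorem1p1:
  fixes m :: nat and \<epsilon> :: real and \<rho> x y :: complex
  assumes "m \<ge> 2"
    and "\<epsilon> ^ 2 = 1"
    and "\<rho> ^ m = complex_of_real \<epsilon>"
  shows "(\<exists>!F. is_L_continuation F) \<and>
         (\<exists>!F. is_regprod_continuation m \<epsilon> F) \<and>
         regprod m \<epsilon> x y = (\<Prod>\<xi> | \<xi> ^ m = 1. L (x - \<xi> * \<rho> * y))"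
proof -
  obtain A B where AB: "is_L_continuation (\<lambda>z. exp (A + B * z) * rGamma z)"
    by (rule is_L_continuation_exp_rGamma)
  have L: "L = (\<lambda>z. exp (A + B * z) * rGamma z)" by (rule L_eq[OF AB])
  hence L_hol: "L holomorphic_on UNIV" using AB by (simp add: is_L_continuation_def)
  define P where "P = (\<lambda>(x, y). \<Prod>\<xi> | \<xi> ^ m = 1. L (x - \<xi> * \<rho> * y))"
  have "entire2 (\<lambda>p. \<Prod>\<xi> | \<xi> ^ m = 1. (\<lambda>(x, y). L (x - \<xi> * \<rho> * y)) p)"
    using assms by (intro entire2_prod entire2_linear_compose L_hol finite_roots_unity) auto
  hence "entire2 P" by (simp add: P_def case_prod_unfold)
  hence P: "is_regprod_continuation m \<epsilon> P"
    using has_zeta_regprod_power_diff[OF assms AB]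
    unfolding is_regprod_continuation_def by (simp add: P_def L)
  have "regprod m \<epsilon> x y = P (x, y)"
    unfolding regprod_def using P is_regprod_continuation_unique by (metis the_equality)
  moreover have "\<exists>!F. is_L_continuation F" using AB is_L_continuation_unique by blast
  moreover have "\<exists>!F. is_regprod_continuation m \<epsilon> F" using P is_regprod_continuation_unique by blast
  ultimately show ?thesis by (simp add: P_def)
qed

end
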